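(* For any PSBA instance with $|E|=1$ (and $|T|$ arbitrary), there is a polynomial-time algorithm that returns an optimal position $t$ for the single event, i.e., a $t\in T$ maximizing $\sum_{i\in A}\mathrm{agr}_i(\{(e,t)\})$.
   Context: PSBA: Time is discrete; $T=\{1,\dots,|T|\}$ is the set of time slots. There is a set $A$ of agents and a set $E$ of events; each event $e$ has length $l(e)\in\mathbb{N}_{\ge1}$ and, scheduled at slot $t$, occupies $\{t,\dots,t+l(e)-1\}$. Each agent $i$ has a job set $J_i$; each job $j$ has release time $r_j$, deadline $d_j$, processing time $p_j\le d_j-r_j+1$, and job interval $\{r_j,\dots,d_j\}$. A preemptive job schedule of $J_i$ is feasible if each job gets $p_j$ distinct slots in its interval and each slot holds at most one job of $J_i$; each $J_i$ is assumed feasible. For a set $\mathcal S$ of pairs $(e,t)$ (event $e$ scheduled at $t$), a slot is an agreement slot of agent $i$ if it is occupied by some scheduled event and no job of $J_i$ is processed there; $\mathrm{agr}_i(\mathcal S)$ is the maximum number of agreement slots over feasible job schedules of $J_i$. *)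

theory Defs
  imports Complex_Main "HOL-Library.Log_Nat" "HOL-Computational_Algebra.Polynomial"
begin

section \<open>PSBA instances\<close>

record job =
  release :: nat
  deadline :: nat
  proc_time :: nat

text \<open>
  Events and agents are identified with their positions in the lists below, and the jobs of an
  agent with their positions in the agent's job list (so distinct jobs may carry equal data).
\<close>

record psba =
  horizon :: nat
  event_lengths :: "nat list"
  agent_jobs :: "job list list"

definition slots :: "psba \<Rightarrow> nat set" where
  "slots I = {1..horizon I}"

definition events :: "psba \<Rightarrow> nat set" where
  "events I = {..<length (event_lengths I)}"

definition agents :: "psba \<Rightarrow> nat set" where
  "agents I = {..<length (agent_jobs I)}"

definition job_interval :: "job \<Rightarrow> nat set" where
  "job_interval j = {release j..deadline j}"

text \<open>A job schedule assigns to each job (position) the set of slots in which it is processed.\<close>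

definition feasible_schedule :: "job list \<Rightarrow> (nat \<Rightarrow> nat set) \<Rightarrow> bool" where
  "feasible_schedule js \<sigma> \<longleftrightarrow>
     (\<forall>k<length js. \<sigma> k \<subseteq> job_interval (js ! k) \<and> card (\<sigma> k) = proc_time (js ! k)) \<and>
     (\<forall>k<length js. \<forall>k'<length js. k \<noteq> k' \<longrightarrow> \<sigma> k \<inter> \<sigma> k' = {})"

text \<open>
  The inequality on \<open>proc_time\<close> is the integer inequality $p_j \le d_j - r_j + 1$, rearranged to
  avoid truncated subtraction.
\<close>

definition valid_psba :: "psba \<Rightarrow> bool" where
  "valid_psba I \<longleftrightarrow>
     horizon I \<ge> 1 \<and>
     (\<forall>e\<in>events I. event_lengths I ! e \<ge> 1) \<and>
     (\<forall>i\<in>agents I.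
        (\<forall>j\<in>set (agent_jobs I ! i).
           release j \<in> slots I \<and> deadline j \<in> slots I \<and>
           proc_time j + release j \<le> deadline j + 1) \<and>
        (\<exists>\<sigma>. feasible_schedule (agent_jobs I ! i) \<sigma>))"

definition occupied :: "psba \<Rightarrow> nat \<Rightarrow> nat \<Rightarrow> nat set" where
  "occupied I e t = {t..t + event_lengths I ! e - 1}"

text \<open>Agreement slots are slots of the horizon: the part of an event beyond it does not count.\<close>

definition agreement_slots ::
  "psba \<Rightarrow> nat \<Rightarrow> (nat \<times> nat) set \<Rightarrow> (nat \<Rightarrow> nat set) \<Rightarrow> nat set" where
  "agreement_slots I i S \<sigma> =
     {s \<in> slots I. (\<exists>(e, t)\<in>S. s \<in> occupied I e t) \<and>
                   (\<forall>k<length (agent_jobs I ! i). s \<notin> \<sigma> k)}"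

definition agr :: "psba \<Rightarrow> nat \<Rightarrow> (nat \<times> nat) set \<Rightarrow> nat" where
  "agr I i S =
     Max {card (agreement_slots I i S \<sigma>) | \<sigma>. feasible_schedule (agent_jobs I ! i) \<sigma>}"

definition optimal_position :: "psba \<Rightarrow> nat \<Rightarrow> nat \<Rightarrow> bool" where
  "optimal_position I e t \<longleftrightarrow>
     is_arg_max (\<lambda>t. \<Sum>i\<in>agents I. agr I i {(e, t)}) (\<lambda>t. t \<in> slots I) t"


section \<open>Polynomial time\<close>

text \<open>
  The machine model is the random access machine with logarithmic cost (in the form of
  structured programs), which is polynomially equivalent to Turing machines: the input is a
  sequence of natural numbers in read-only cells, the memory consists of unboundedly many cells
  holding natural numbers, and every operation is charged the number of binary digits of the
  numbers (values and addresses) it handles.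
\<close>

definition num_bits :: "nat \<Rightarrow> nat" where
  "num_bits n = max 1 (floorlog 2 n)"

datatype exp =
    Const nat
  | Input exp
  | Mem exp
  | Add exp exp
  | Sub exp exp
  | Mul exp exp
  | Div exp exp

datatype com =
    Skip
  | Store exp exp
  | Seq com com
  | Cond exp com com
  | While exp com

text \<open>Input cells beyond the end of the input read as 0.\<close>

primrec val :: "nat list \<Rightarrow> (nat \<Rightarrow> nat) \<Rightarrow> exp \<Rightarrow> nat" where
  "val xs m (Const n) = n"
| "val xs m (Input a) = (let k = val xs m a in if k < length xs then xs ! k else 0)"
| "val xs m (Mem a) = m (val xs m a)"
| "val xs m (Add a b) = val xs m a + val xs m b"
| "val xs m (Sub a b) = val xs m a - val xs m b"
| "val xs m (Mul a b) = val xs m a * val xs m b"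
| "val xs m (Div a b) = val xs m a div val xs m b"

text \<open>
  Each node is charged for its result; operands and addresses are the results of the
  children and are charged there.
\<close>

primrec cost :: "nat list \<Rightarrow> (nat \<Rightarrow> nat) \<Rightarrow> exp \<Rightarrow> nat" where
  "cost xs m (Const n) = num_bits n"
| "cost xs m (Input a) = cost xs m a + num_bits (val xs m (Input a))"
| "cost xs m (Mem a) = cost xs m a + num_bits (val xs m (Mem a))"
| "cost xs m (Add a b) = cost xs m a + cost xs m b + num_bits (val xs m (Add a b))"
| "cost xs m (Sub a b) = cost xs m a + cost xs m b + num_bits (val xs m (Sub a b))"
| "cost xs m (Mul a b) = cost xs m a + cost xs m b + num_bits (val xs m (Mul a b))"
| "cost xs m (Div a b) = cost xs m a + cost xs m b + num_bits (val xs m (Div a b))"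

text \<open>
  \<open>run xs c m n m'\<close>: on input \<open>xs\<close>, program \<open>c\<close> started in memory \<open>m\<close> halts in memory \<open>m'\<close>
  at total cost \<open>n\<close>. A guard is true iff its value is nonzero.
\<close>

inductive run :: "nat list \<Rightarrow> com \<Rightarrow> (nat \<Rightarrow> nat) \<Rightarrow> nat \<Rightarrow> (nat \<Rightarrow> nat) \<Rightarrow> bool"
  for xs :: "nat list" where
  Skip: "run xs Skip m 1 m"
| Store: "run xs (Store a b) m (cost xs m a + cost xs m b) (m(val xs m a := val xs m b))"
| Seq: "run xs c1 m n1 m1 \<Longrightarrow> run xs c2 m1 n2 m2 \<Longrightarrow> run xs (Seq c1 c2) m (n1 + n2) m2"
| CondTrue: "val xs m b \<noteq> 0 \<Longrightarrow> run xs c1 m n m' \<Longrightarrow> run xs (Cond b c1 c2) m (cost xs m b + n) m'"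
| CondFalse: "val xs m b = 0 \<Longrightarrow> run xs c2 m n m' \<Longrightarrow> run xs (Cond b c1 c2) m (cost xs m b + n) m'"
| WhileFalse: "val xs m b = 0 \<Longrightarrow> run xs (While b c) m (cost xs m b) m"
| WhileTrue: "val xs m b \<noteq> 0 \<Longrightarrow> run xs c m n1 m1 \<Longrightarrow> run xs (While b c) m1 n2 m2 \<Longrightarrow>
    run xs (While b c) m (cost xs m b + n1 + n2) m2"

inductive_cases SkipE: "run xs Skip m n m'"
inductive_cases StoreE: "run xs (Store a b) m n m'"
inductive_cases SeqE: "run xs (Seq c1 c2) m n m'"
inductive_cases CondE: "run xs (Cond b c1 c2) m n m'"
inductive_cases WhileE: "run xs (While b c) m n m'"

lemma run_deterministic:
  "run xs c m n m' \<Longrightarrow> run xs c m k m'' \<Longrightarrow> k = n \<and> m'' = m'"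
proof (induction arbitrary: k m'' rule: run.induct)
  case (Skip m)
  then show ?case by (auto elim: SkipE)
next
  case (Store a b m)
  then show ?case by (auto elim: StoreE)
next
  case (Seq c1 m n1 m1 c2 n2 m2)
  from Seq.prems show ?case
    by (rule SeqE) (fastforce dest: Seq.IH)
next
  case (CondTrue m b c1 n m' c2)
  from CondTrue.prems show ?case
    by (rule CondE) (use CondTrue.hyps in \<open>fastforce dest: CondTrue.IH\<close>)+
next
  case (CondFalse m b c2 n m' c1)
  from CondFalse.prems show ?case
    by (rule CondE) (use CondFalse.hyps in \<open>fastforce dest: CondFalse.IH\<close>)+
next
  case (WhileFalse m b c)
  from WhileFalse.prems show ?case
    by (rule WhileE) (use WhileFalse.hyps in auto)
next
  case (WhileTrue m b c n1 m1 n2 m2)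
  from WhileTrue.prems show ?case
    by (rule WhileE) (use WhileTrue.hyps in \<open>fastforce dest: WhileTrue.IH\<close>)+
qed

definition input_size :: "nat list \<Rightarrow> nat" where
  "input_size xs = (\<Sum>x\<leftarrow>xs. num_bits x)"

text \<open>
  The program \<open>c\<close> solves the search problem \<open>sol\<close> on the instances satisfying \<open>valid\<close>, encoded
  by \<open>enc\<close>, in polynomial time. The memory is initially zero and cell 0 holds the output.
\<close>

definition solves_in_poly_time ::
  "com \<Rightarrow> ('a \<Rightarrow> nat list) \<Rightarrow> ('a \<Rightarrow> bool) \<Rightarrow> ('a \<Rightarrow> nat \<Rightarrow> bool) \<Rightarrow> bool" where
  "solves_in_poly_time c enc valid sol \<longleftrightarrow>
     (\<exists>q :: nat poly. \<forall>x. valid x \<longrightarrow>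
        (\<exists>n m. run (enc x) c (\<lambda>_. 0) n m \<and> n \<le> poly q (input_size (enc x)) \<and> sol x (m 0)))"

text \<open>All numbers, including the number of slots, enter the input size with their binary length.\<close>

definition encode_job :: "job \<Rightarrow> nat list" where
  "encode_job j = [release j, deadline j, proc_time j]"

definition encode_agent :: "job list \<Rightarrow> nat list" where
  "encode_agent js = length js # concat (map encode_job js)"

definition encode_psba :: "psba \<Rightarrow> nat list" where
  "encode_psba I =
     horizon I # length (event_lengths I) # event_lengths I @
     length (agent_jobs I) # concat (map encode_agent (agent_jobs I))"

end

theory Submission
  imports Defs
begin

text \<open>
  The horizon is given in binary, so positions cannot be enumerated. By an augmentation argument
  (Hall's theorem for interval jobs), the number of slots of a window \<open>W\<close> that an agent must keep
  busy is the maximum, over a release time \<open>u\<close> and a deadline \<open>v\<close>, of the processing time of the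
  jobs confined to \<open>{u..v}\<close> minus the number of slots of \<open>{u..v}\<close> outside \<open>W\<close>. Hence the total
  number of forced slots of the window \<open>{t..<t + l}\<close>, its load, is computable in polynomial time,
  and as a function of \<open>t\<close> it is convex except where \<open>t\<close> is a release time or \<open>t + l - 1\<close> is a
  deadline. As later positions only cut off the window, it suffices to minimise the load over
  \<open>1 \<le> t \<le> max 1 (horizon + 1 - l)\<close>. This is done by a binary search between each pair of the
  polynomially many exceptional points; for adjacent points the search is correct by convexity.
\<close>

section \<open>Slots forced to be busy\<close>

text \<open>Overlapping a fixed interval \<open>{u..v}\<close> with a sliding window gives a
  trapezoid as a function of \<open>t\<close>. Its slope drops only at \<open>t = u\<close> and
  \<open>t + l = v + 1\<close>; at the two outer corners it rises. Adding constants, truncating at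
  0, maxima and sums preserve convexity, so no other exceptional points arise for the load.
  Selecting adjacent exceptional points would require sorting. Instead all ordered pairs of
  candidates are searched, and a search result is accepted only if its load beats that of the best
  position so far. On a stretch that is not convex the search still returns an admissible position,
  which therefore does no harm; it is enough that every position is bracketed by some pair with
  convexity in between. Numbers can be exponential in the input size, so the cost of each operation
  matters. A single bound \<open>V\<close> with linearly many bits is maintained for all memory
  cells; expressions of bounded width then have linear cost, and it remains to count assignments and
  guards.\<close>

definition busy :: "job list \<Rightarrow> (nat \<Rightarrow> nat set) \<Rightarrow> nat set" where
  "busy js \<sigma> = (\<Union>k<length js. \<sigma> k)"

definition demand :: "job list \<Rightarrow> nat \<Rightarrow> nat \<Rightarrow> nat" where
  "demand js u v =
     (\<Sum>k<length js. if u \<le> release (js ! k) \<and> deadline (js ! k) \<le> v then proc_time (js ! k) else 0)"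

text \<open>The size of \<open>{u..v} \<inter> {t..<t + l}\<close>; truncation yields 0 when the two
  are disjoint.\<close>

definition overlap :: "nat \<Rightarrow> nat \<Rightarrow> nat \<Rightarrow> nat \<Rightarrow> nat" where
  "overlap l u v t = min (v + 1) (t + l) - max u t"

text \<open>Arranged so that only \<open>overlap\<close> depends on \<open>t\<close>; the final
  truncated subtraction acts as a maximum with 0.\<close>

definition excess :: "job list \<Rightarrow> nat \<Rightarrow> nat \<Rightarrow> nat \<Rightarrow> nat \<Rightarrow> nat" where
  "excess js l u v t = demand js u v + overlap l u v t - (v + 1 - u)"

text \<open>Accumulated index by index, as the loops of the program do it. The value 0 on the empty
  range means that an agent without jobs forces nothing.\<close>

primrec max_below :: "(nat \<Rightarrow> nat) \<Rightarrow> nat \<Rightarrow> nat" where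
  "max_below f 0 = 0"
| "max_below f (Suc n) = max (max_below f n) (f n)"

definition forced :: "job list \<Rightarrow> nat \<Rightarrow> nat \<Rightarrow> nat" where
  "forced js l t =
     max_below (\<lambda>k. max_below (\<lambda>k'. excess js l (release (js ! k)) (deadline (js ! k')) t) (length js)) (length js)"

lemma max_below_le_iff: "max_below f n \<le> b \<longleftrightarrow> (\<forall>k<n. f k \<le> b)"
  by (induction n) (auto simp: less_Suc_eq)

lemma le_max_below: "k < n \<Longrightarrow> f k \<le> max_below f n"
  using max_below_le_iff[of f n "max_below f n"] by auto

lemma card_Int_atLeastAtMost: "card ({u..v} \<inter> {t..<t + l}) = overlap l u v t"
proof -
  have "{u..v} \<inter> {t..<t + l} = {max u t..<min (v + 1) (t + l)}" by auto
  then show ?thesis by (simp add: overlap_def)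
qed

lemma card_Diff_atLeastAtMost: "card ({u..v} - {t..<t + l}) + overlap l u v t = v + 1 - u"
proof -
  have "card ({u..v} - {t..<t + l}) + card ({u..v} \<inter> {t..<t + l}) = card {u..v}"
    by (subst card_Un_disjoint[symmetric]) (auto simp: Un_Int_distrib simp del: card_atLeastAtMost intro!: arg_cong[where f=card])
  then show ?thesis by (simp add: card_Int_atLeastAtMost)
qed

lemma overlap_le: "overlap l u v t \<le> v + 1 - u"
  using card_Diff_atLeastAtMost[of u v t l] by simp

context
  fixes js :: "job list"
begin

lemma feasible_finite:
  assumes "feasible_schedule js \<sigma>" "k < length js"
  shows "finite (\<sigma> k)"
  using assms finite_subset[of "\<sigma> k" "job_interval (js ! k)"]
  by (auto simp: feasible_schedule_def job_interval_def)

lemma finite_busy: "feasible_schedule js \<sigma> \<Longrightarrow> finite (busy js \<sigma>)"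
  by (auto simp: busy_def feasible_finite)

lemma card_UN_feasible:
  assumes "feasible_schedule js \<sigma>" "K \<subseteq> {..<length js}"
  shows "card (\<Union>k\<in>K. \<sigma> k) = (\<Sum>k\<in>K. proc_time (js ! k))"
proof -
  have "card (\<Union>k\<in>K. \<sigma> k) = (\<Sum>k\<in>K. card (\<sigma> k))"
  proof (rule card_UN_disjoint)
    show "finite K" using assms(2) finite_subset by blast
    show "\<forall>k\<in>K. finite (\<sigma> k)" using assms feasible_finite by blast
    show "\<forall>k\<in>K. \<forall>k'\<in>K. k \<noteq> k' \<longrightarrow> \<sigma> k \<inter> \<sigma> k' = {}"
      using assms unfolding feasible_schedule_def by blast
  qed
  also have "\<dots> = (\<Sum>k\<in>K. proc_time (js ! k))"
    using assms by (intro sum.cong) (auto simp: feasible_schedule_def)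
  finally show ?thesis .
qed

text \<open>The jobs confined to \<open>{u..v}\<close> fill \<open>demand js u v\<close> distinct
  slots of it, and at most \<open>card ({u..v} - {t..<t + l})\<close> of these avoid the
  window.\<close>

lemma excess_le_busy:
  assumes "feasible_schedule js \<sigma>"
  shows "excess js l u v t \<le> card (busy js \<sigma> \<inter> {t..<t + l})"
proof -
  let ?K = "{k. k < length js \<and> u \<le> release (js ! k) \<and> deadline (js ! k) \<le> v}"
  have K: "?K \<subseteq> {..<length js}" by auto
  have "demand js u v = (\<Sum>k\<in>?K. proc_time (js ! k))"
    unfolding demand_def by (subst sum.inter_filter[symmetric]) (auto intro!: sum.cong)
  also have "\<dots> = card (\<Union>k\<in>?K. \<sigma> k)" using card_UN_feasible[OF assms K] by simp
  also have "\<dots> \<le> card ((busy js \<sigma> \<inter> {t..<t + l}) \<union> ({u..v} - {t..<t + l}))"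
  proof (rule card_mono)
    show "finite (busy js \<sigma> \<inter> {t..<t + l} \<union> ({u..v} - {t..<t + l}))" by simp
    show "(\<Union>k\<in>?K. \<sigma> k) \<subseteq> busy js \<sigma> \<inter> {t..<t + l} \<union> ({u..v} - {t..<t + l})"
      using assms by (fastforce simp: feasible_schedule_def busy_def job_interval_def)
  qed
  also have "\<dots> \<le> card (busy js \<sigma> \<inter> {t..<t + l}) + card ({u..v} - {t..<t + l})"
    by (rule card_Un_le)
  finally show ?thesis
    using card_Diff_atLeastAtMost[of u v t l] by (simp add: excess_def)
qed

lemma forced_le_busy:
  "feasible_schedule js \<sigma> \<Longrightarrow> forced js l t \<le> card (busy js \<sigma> \<inter> {t..<t + l})"
  by (auto simp: forced_def max_below_le_iff excess_le_busy)

section \<open>Tightness of the bound by alternating paths\<close>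

text \<open>
  The slots reachable from \<open>W\<close> by at most \<open>n\<close> alternating steps; a free one outside \<open>W\<close> is the end
  of an augmenting path that empties a slot of \<open>W\<close>.
\<close>

primrec reach :: "nat set \<Rightarrow> (nat \<Rightarrow> nat set) \<Rightarrow> nat \<Rightarrow> nat set" where
  "reach W \<sigma> 0 = W"
| "reach W \<sigma> (Suc n) = reach W \<sigma> n \<union>
     (\<Union>k\<in>{k. k < length js \<and> \<sigma> k \<inter> reach W \<sigma> n \<noteq> {}}. job_interval (js ! k))"

lemma reach_mono: "m \<le> n \<Longrightarrow> reach W \<sigma> m \<subseteq> reach W \<sigma> n"
  by (rule lift_Suc_mono_le) auto

text \<open>A level depends only on how the jobs meet the level below it, so moving a job between
  slots outside level \<open>n\<close> leaves all levels up to \<open>Suc n\<close> intact.\<close>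

lemma reach_cong:
  assumes "\<And>k. k < length js \<Longrightarrow> \<sigma> k \<inter> reach W \<sigma> n = \<sigma>' k \<inter> reach W \<sigma> n"
    and "m \<le> Suc n"
  shows "reach W \<sigma>' m = reach W \<sigma> m"
  using assms(2)
proof (induction m)
  case (Suc m)
  then have eq: "reach W \<sigma>' m = reach W \<sigma> m" by simp
  have "\<sigma> k \<inter> reach W \<sigma> m = \<sigma>' k \<inter> reach W \<sigma> m" if "k < length js" for k
    using assms(1)[OF that] reach_mono[of m n W \<sigma>] Suc.prems by auto
  then have "{k. k < length js \<and> \<sigma>' k \<inter> reach W \<sigma> m \<noteq> {}} = {k. k < length js \<and> \<sigma> k \<inter> reach W \<sigma> m \<noteq> {}}"
    by auto
  then show ?case using eq by simp
qed auto

lemma feasible_move: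
  assumes "feasible_schedule js \<sigma>" "k < length js" "s \<in> \<sigma> k"
    and "f \<in> job_interval (js ! k)" "f \<notin> busy js \<sigma>"
  defines "\<sigma>' \<equiv> \<sigma>(k := insert f (\<sigma> k - {s}))"
  shows "feasible_schedule js \<sigma>'" "busy js \<sigma>' = insert f (busy js \<sigma> - {s})"
proof -
  have dis: "\<sigma> k \<inter> \<sigma> k' = {}" if "k' < length js" "k' \<noteq> k" for k'
    using assms(1,2) that unfolding feasible_schedule_def by blast
  have fr: "f \<notin> \<sigma> k'" if "k' < length js" for k' using assms(5) that by (auto simp: busy_def)
  have fin: "finite (\<sigma> k)" using assms feasible_finite by blast
  have "card (insert f (\<sigma> k - {s})) = card (\<sigma> k)"
    using fin fr[OF assms(2)] assms(3)
    by (metis Diff_iff card_Suc_Diff1 card_insert_disjoint finite_Diff)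
  moreover have "insert f (\<sigma> k - {s}) \<inter> \<sigma> k' = {}" if "k' < length js" "k' \<noteq> k" for k'
    using dis[OF that] fr[OF that(1)] by blast
  ultimately show "feasible_schedule js \<sigma>'"
    using assms(1,2,4) unfolding feasible_schedule_def \<sigma>'_def by (auto simp: Int_commute)
  have "busy js \<sigma>' = insert f (\<sigma> k - {s}) \<union> (\<Union>k'\<in>{..<length js} - {k}. \<sigma> k')"
    using assms(2) unfolding busy_def \<sigma>'_def by (auto split: if_splits)
  also have "(\<Union>k'\<in>{..<length js} - {k}. \<sigma> k') = (\<Union>k'\<in>{..<length js} - {k}. \<sigma> k') - {s}"
    using dis assms(3) by blast
  also have "insert f (\<sigma> k - {s}) \<union> \<dots> = insert f (busy js \<sigma> - {s})"
    using assms(2) unfolding busy_def by auto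
  finally show "busy js \<sigma>' = insert f (busy js \<sigma> - {s})" .
qed

text \<open>The augmenting path is traversed backwards: the job holding \<open>s\<close> moves to
  the free slot \<open>f\<close>, which frees \<open>s\<close> one level earlier. The count in
  \<open>W\<close> is unchanged until the freed slot lies in \<open>W\<close>.\<close>

lemma reduce_busy:
  assumes "feasible_schedule js \<sigma>" "\<not> reach W \<sigma> n - W \<subseteq> busy js \<sigma>"
  shows "\<exists>\<sigma>'. feasible_schedule js \<sigma>' \<and> card (busy js \<sigma>' \<inter> W) < card (busy js \<sigma> \<inter> W)"
  using assms
proof (induction n arbitrary: \<sigma>)
  case (Suc n)
  show ?case
  proof (cases "reach W \<sigma> n - W \<subseteq> busy js \<sigma>")
    case False
    then show ?thesis using Suc by blast
  next
    case True
    then obtain f k s where f: "f \<notin> W" "f \<notin> busy js \<sigma>" "f \<notin> reach W \<sigma> n"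
      and k: "k < length js" "f \<in> job_interval (js ! k)" and s: "s \<in> \<sigma> k" "s \<in> reach W \<sigma> n"
      using Suc.prems(2) by auto
    define \<sigma>' where "\<sigma>' = \<sigma>(k := insert f (\<sigma> k - {s}))"
    note mv = feasible_move[OF Suc.prems(1) k(1) s(1) k(2) f(2), folded \<sigma>'_def]
    have sb: "s \<in> busy js \<sigma>" using k s by (auto simp: busy_def)
    have int: "busy js \<sigma>' \<inter> W = busy js \<sigma> \<inter> W - {s}" using mv f by auto
    show ?thesis
    proof (cases "s \<in> W")
      case True
      have "card (busy js \<sigma>' \<inter> W) < card (busy js \<sigma> \<inter> W)"
        unfolding int using sb True finite_busy[OF Suc.prems(1)]
        by (intro psubset_card_mono) auto
      then show ?thesis using mv by blast
    next
      case False
      then obtain n' where n: "n = Suc n'" using s by (cases n) auto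
      \<comment> \<open>Had \<open>s\<close> been reached one level earlier, job \<open>k\<close>
        would have put \<open>f\<close> into level \<open>n\<close>. So the move takes place outside
        level \<open>n'\<close>, and level \<open>n\<close> survives it.\<close>
      have "s \<notin> reach W \<sigma> n'" using f k s unfolding n by auto
      moreover have "f \<notin> reach W \<sigma> n'" using f reach_mono[of n' n W \<sigma>] n by auto
      ultimately have "reach W \<sigma>' n = reach W \<sigma> n"
        by (intro reach_cong[of _ _ n']) (auto simp: n \<sigma>'_def)
      moreover have "s \<notin> busy js \<sigma>'" using mv f sb by auto
      ultimately have "\<not> reach W \<sigma>' n - W \<subseteq> busy js \<sigma>'" using s False by auto
      with Suc.IH[OF mv(1)] show ?thesis using int False by auto
    qed
  qed
qed auto


text \<open>Every added job interval contains a slot \<open>s\<close> reached before. A point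
  between \<open>x\<close> and the window is either between \<open>s\<close> and the window or
  inside that job interval.\<close>

lemma reach_convex:
  assumes "feasible_schedule js \<sigma>" "a \<le> b"
    and "x \<in> reach {a..b} \<sigma> n" "min x a \<le> z" "z \<le> max x b"
  shows "z \<in> reach {a..b} \<sigma> n"
  using assms(3-)
proof (induction n arbitrary: x z)
  case (Suc n)
  show ?case
  proof (cases "x \<in> reach {a..b} \<sigma> n")
    case True
    then show ?thesis using Suc by auto
  next
    case False
    then obtain k s where k: "k < length js" "x \<in> job_interval (js ! k)"
      and s: "s \<in> \<sigma> k" "s \<in> reach {a..b} \<sigma> n"
      using Suc.prems(1) by auto
    have si: "s \<in> job_interval (js ! k)" using k s assms(1) by (auto simp: feasible_schedule_def)
    show ?thesis
    proof (cases "min s a \<le> z \<and> z \<le> max s b")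
      case True
      then show ?thesis using Suc.IH[OF s(2)] by auto
    next
      case False
      then have "z \<in> job_interval (js ! k)"
        using si k(2) Suc.prems(2,3) by (auto simp: job_interval_def min_def max_def split: if_splits)
      then show ?thesis using k s by auto
    qed
  qed
qed (use assms(2) in \<open>auto simp: min_def max_def split: if_splits\<close>)

lemma reach_stable: "\<exists>n. reach {a..b} \<sigma> (Suc n) = reach {a..b} \<sigma> n"
proof (rule ccontr)
  assume no: "\<nexists>n. reach {a..b} \<sigma> (Suc n) = reach {a..b} \<sigma> n"
  have fin: "finite (reach {a..b} \<sigma> n)" for n
    by (induction n) (auto simp: job_interval_def)
  have "reach {a..b} \<sigma> n \<subset> reach {a..b} \<sigma> (Suc n)" for n
    using no reach_mono[of n "Suc n" "{a..b}" \<sigma>] by (metis le_Suc_eq order.refl psubsetI)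
  then have lt: "card (reach {a..b} \<sigma> n) < card (reach {a..b} \<sigma> (Suc n))" for n
    using fin psubset_card_mono by blast
  have ge: "n \<le> card (reach {a..b} \<sigma> n)" for n
    by (induction n) (use lt in \<open>auto intro: Suc_leI le_less_trans\<close>)
  let ?U = "{a..b} \<union> (\<Union>k<length js. job_interval (js ! k))"
  have "reach {a..b} \<sigma> n \<subseteq> ?U" for n by (induction n) auto
  then have "card (reach {a..b} \<sigma> n) \<le> card ?U" for n
    by (intro card_mono) (auto simp: job_interval_def)
  then show False using ge[of "Suc (card ?U)"] le_trans not_less_eq_eq by blast
qed

text \<open>A schedule with fewest busy slots in the window has no augmenting path. The stable
  reached set \<open>U\<close> is then busy outside the window, and the jobs meeting
  \<open>U\<close> stay inside \<open>U\<close>; their earliest release time and latest deadline are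
  the pair that makes the bound tight.\<close>

lemma busy_le_forced:
  assumes "feasible_schedule js \<sigma>0" "1 \<le> l"
  shows "\<exists>\<sigma>. feasible_schedule js \<sigma> \<and> card (busy js \<sigma> \<inter> {t..<t + l}) \<le> forced js l t"
proof -
  define W where "W = {t..<t + l}"
  have W: "W = {t..t + l - 1}" using assms(2) by (auto simp: W_def)
  obtain \<sigma> where feas: "feasible_schedule js \<sigma>"
    and min: "\<And>\<sigma>'. feasible_schedule js \<sigma>' \<Longrightarrow> card (busy js \<sigma> \<inter> W) \<le> card (busy js \<sigma>' \<inter> W)"
    using exists_least_iff[of "\<lambda>n. \<exists>\<sigma>. feasible_schedule js \<sigma> \<and> card (busy js \<sigma> \<inter> W) = n"] assms(1)
    by (metis not_le_imp_less)
  obtain n where n: "reach W \<sigma> (Suc n) = reach W \<sigma> n" using reach_stable[of t "t+l-1" \<sigma>] W by auto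
  define U where "U = reach W \<sigma> n"
  have WU: "W \<subseteq> U" using reach_mono[of 0 n W \<sigma>] by (auto simp: U_def)
  have full: "U - W \<subseteq> busy js \<sigma>" using reduce_busy[OF feas] min unfolding U_def by (meson not_le)
  have finB: "finite (busy js \<sigma>)" using finite_busy feas .
  define K where "K = {k. k < length js \<and> \<sigma> k \<inter> U \<noteq> {}}"
  have KU: "job_interval (js ! k) \<subseteq> U" if "k \<in> K" for k
    using n that unfolding U_def K_def by auto
  show ?thesis
  \<comment> \<open>Without a busy slot in the window, \<open>K\<close> may be empty and there is no
    \<open>u\<close> or \<open>v\<close> to choose.\<close>
  proof (cases "busy js \<sigma> \<inter> W = {}")
    case True
    then show ?thesis using feas unfolding W_def by (metis card.empty le0)
  next
    case False
    then have "K \<noteq> {}" using WU by (auto simp: K_def busy_def)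
    have finK: "finite K" by (simp add: K_def)
    obtain k where k: "k \<in> K" "\<And>i. i \<in> K \<Longrightarrow> release (js ! k) \<le> release (js ! i)"
      using ex_is_arg_min_if_finite[OF finK \<open>K \<noteq> {}\<close>, of "\<lambda>i. release (js ! i)"]
      by (auto simp: is_arg_min_linorder)
    obtain k' where k': "k' \<in> K" "\<And>i. i \<in> K \<Longrightarrow> deadline (js ! i) \<le> deadline (js ! k')"
      using finK \<open>K \<noteq> {}\<close> Max_in[of "(\<lambda>i. deadline (js ! i)) ` K"]
      by (metis (no_types, lifting) Max_ge finite_imageI imageE imageI image_is_empty)
    define u v where "u = release (js ! k)" and "v = deadline (js ! k')"
    have len: "k < length js" "k' < length js" using k k' by (auto simp: K_def)
    have ne: "\<exists>s. s \<in> job_interval (js ! i)" if "i \<in> K" for i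
      using that feas unfolding K_def feasible_schedule_def by blast
    have uU: "u \<in> U" "v \<in> U"
      using ne[OF k(1)] KU[OF k(1)] ne[OF k'(1)] KU[OF k'(1)]
      by (auto simp: u_def v_def job_interval_def)
    \<comment> \<open>A point up to the end of the window is reached because \<open>u\<close> is, a
      later one because \<open>v\<close> is.\<close>
    have uvU: "{u..v} \<subseteq> U"
    proof
      fix z assume z: "z \<in> {u..v}"
      show "z \<in> U"
      proof (cases "z \<le> t + l - 1")
        case True
        then show ?thesis using reach_convex[OF feas, of t "t+l-1" u n z] uU z assms(2)
          unfolding U_def W by auto
      next
        case False
        then show ?thesis using reach_convex[OF feas, of t "t+l-1" v n z] uU z assms(2)
          unfolding U_def W by auto
      qed
    qed
    have "busy js \<sigma> \<inter> U \<subseteq> (\<Union>k\<in>K. \<sigma> k)" by (auto simp: K_def busy_def)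
    then have "card (busy js \<sigma> \<inter> U) \<le> card (\<Union>k\<in>K. \<sigma> k)"
      using finK feas by (intro card_mono) (auto simp: K_def feasible_finite)
    also have "\<dots> = (\<Sum>i\<in>K. proc_time (js ! i))"
      by (rule card_UN_feasible[OF feas]) (auto simp: K_def)
    also have "\<dots> = (\<Sum>i\<in>K. if u \<le> release (js ! i) \<and> deadline (js ! i) \<le> v then proc_time (js ! i) else 0)"
      using k k' by (intro sum.cong) (auto simp: u_def v_def)
    also have "\<dots> \<le> demand js u v"
      unfolding demand_def by (rule sum_mono2) (auto simp: K_def)
    finally have 1: "card (busy js \<sigma> \<inter> U) \<le> demand js u v" .
    \<comment> \<open>By \<open>full\<close>, all slots of \<open>{u..v}\<close> outside
      \<open>W\<close> are busy, so they use up their share of the demand.\<close>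
    have "card (busy js \<sigma> \<inter> W) + card ({u..v} - W) = card (busy js \<sigma> \<inter> W \<union> ({u..v} - W))"
      using finB by (subst card_Un_disjoint) auto
    also have "\<dots> \<le> card (busy js \<sigma> \<inter> U)"
      using finB WU uvU full by (intro card_mono) auto
    finally have "card (busy js \<sigma> \<inter> W) \<le> excess js l u v t"
      using 1 card_Diff_atLeastAtMost[of u v t l] by (simp add: excess_def W_def)
    also have "\<dots> \<le> max_below (\<lambda>k'. excess js l u (deadline (js ! k')) t) (length js)"
      using le_max_below[OF len(2), of "\<lambda>k'. excess js l u (deadline (js ! k')) t"] by (simp add: v_def)
    also have "\<dots> \<le> forced js l t"
      using le_max_below[OF len(1), of "\<lambda>k. max_below (\<lambda>k'. excess js l (release (js ! k)) (deadline (js ! k')) t) (length js)"]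
      by (simp add: forced_def u_def)
    finally show ?thesis using feas W_def by blast
  qed
qed

end

section \<open>From agreement slots to the load\<close>

definition load :: "job list list \<Rightarrow> nat \<Rightarrow> nat \<Rightarrow> nat" where
  "load jss l t = (\<Sum>i<length jss. forced (jss ! i) l t)"

text \<open>Agreement slots and busy slots partition the part of the window within the horizon.
  Hence the most agreement comes from the fewest busy slots, which \<open>forced\<close> counts
  exactly.\<close>

lemma agr_add_forced:
  assumes "valid_psba I" "i \<in> agents I" "e \<in> events I"
  defines "l \<equiv> event_lengths I ! e"
  shows "agr I i {(e, t)} + forced (agent_jobs I ! i) l t = card (slots I \<inter> {t..<t + l})"
proof -
  define js where "js = agent_jobs I ! i"
  let ?A = "{card (agreement_slots I i {(e, t)} \<sigma>) | \<sigma>. feasible_schedule js \<sigma>}"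
  have l: "1 \<le> l" and win: "\<And>j. j \<in> set js \<Longrightarrow> release j \<in> slots I \<and> deadline j \<in> slots I"
    and ex: "\<exists>\<sigma>. feasible_schedule js \<sigma>"
    using assms by (auto simp: valid_psba_def js_def)
  have occ: "occupied I e t = {t..<t + l}" using l by (auto simp: occupied_def l_def)
  have count: "card (agreement_slots I i {(e, t)} \<sigma>) + card (busy js \<sigma> \<inter> {t..<t + l}) = card (slots I \<inter> {t..<t + l})"
    if "feasible_schedule js \<sigma>" for \<sigma>
  proof -
    have "busy js \<sigma> \<subseteq> slots I"
    proof
      fix s assume "s \<in> busy js \<sigma>"
      then obtain k where "k < length js" "s \<in> \<sigma> k" by (auto simp: busy_def)
      then have "k < length js" "s \<in> job_interval (js ! k)"
        using that by (auto simp: feasible_schedule_def)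
      then show "s \<in> slots I" using win[of "js ! k"] by (auto simp: job_interval_def slots_def)
    qed
    then have "slots I \<inter> {t..<t + l} = agreement_slots I i {(e, t)} \<sigma> \<union> busy js \<sigma> \<inter> {t..<t + l}"
      and "agreement_slots I i {(e, t)} \<sigma> \<inter> (busy js \<sigma> \<inter> {t..<t + l}) = {}"
      by (auto simp: agreement_slots_def occ busy_def js_def)
    moreover have "finite (agreement_slots I i {(e, t)} \<sigma>)" by (simp add: agreement_slots_def slots_def)
    ultimately show ?thesis by (simp add: card_Un_disjoint)
  qed
  obtain \<sigma> where \<sigma>: "feasible_schedule js \<sigma>" "card (busy js \<sigma> \<inter> {t..<t + l}) \<le> forced js l t"
    using busy_le_forced l ex by blast
  have "Max ?A = card (agreement_slots I i {(e, t)} \<sigma>)"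
  proof (rule Max_eqI)
    have "?A \<subseteq> {..card (slots I \<inter> {t..<t + l})}"
      using count by (auto, metis le_add1)
    then show "finite ?A" using finite_subset by blast
    show "card (agreement_slots I i {(e, t)} \<sigma>) \<in> ?A" using \<sigma> by blast
    show "y \<le> card (agreement_slots I i {(e, t)} \<sigma>)" if y: "y \<in> ?A" for y
    proof -
      obtain \<sigma>' where "feasible_schedule js \<sigma>'" "y = card (agreement_slots I i {(e, t)} \<sigma>')"
        using y by blast
      then show ?thesis
        using \<sigma> count[OF \<sigma>(1)] count[of \<sigma>'] forced_le_busy[of js \<sigma>' l t] by linarith
    qed
  qed
  then show ?thesis
    using count[OF \<sigma>(1)] \<sigma> forced_le_busy[OF \<sigma>(1), of l t] by (simp add: agr_def js_def)
qed

text \<open>Compared schedule by schedule. This serves the positions at which the event overhangs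
  the horizon, where the window no longer has constant size.\<close>

lemma agr_mono:
  assumes "valid_psba I" "i \<in> agents I" "e \<in> events I"
    and sub: "slots I \<inter> occupied I e t \<subseteq> occupied I e t'"
  shows "agr I i {(e, t)} \<le> agr I i {(e, t')}"
proof -
  let ?F = "{\<sigma>. feasible_schedule (agent_jobs I ! i) \<sigma>}"
  have eq: "agr I i {(e, t)} = Max ((\<lambda>\<sigma>. card (agreement_slots I i {(e, t)} \<sigma>)) ` ?F)" for t
    unfolding agr_def by (rule arg_cong[where f=Max]) auto
  have fin: "finite ((\<lambda>\<sigma>. card (agreement_slots I i {(e, t)} \<sigma>)) ` ?F)" for t
    by (rule finite_subset[of _ "{..card (slots I)}"])
      (auto simp: agreement_slots_def slots_def intro!: card_mono[of "{Suc 0..horizon I}", simplified])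
  have ne: "?F \<noteq> {}" using assms by (auto simp: valid_psba_def)
  have "card (agreement_slots I i {(e, t)} \<sigma>) \<le> card (agreement_slots I i {(e, t')} \<sigma>)" for \<sigma>
    using sub by (intro card_mono) (auto simp: agreement_slots_def slots_def)
  then have "y \<le> Max ((\<lambda>\<sigma>. card (agreement_slots I i {(e, t')} \<sigma>)) ` ?F)"
    if "y \<in> (\<lambda>\<sigma>. card (agreement_slots I i {(e, t)} \<sigma>)) ` ?F" for y
    using that Max_ge[OF fin, of _ t'] order_trans by blast
  then show ?thesis unfolding eq using fin ne by (intro Max.boundedI) auto
qed

lemma optimal_position_if_min_load:
  assumes I: "valid_psba I" "e \<in> events I"
  defines "l \<equiv> event_lengths I ! e"
  defines "M \<equiv> max 1 (horizon I + 1 - l)"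
  assumes t: "1 \<le> t" "t \<le> M"
    and min: "\<And>t'. 1 \<le> t' \<Longrightarrow> t' \<le> M \<Longrightarrow> load (agent_jobs I) l t \<le> load (agent_jobs I) l t'"
  shows "optimal_position I e t"
proof -
  have l: "1 \<le> l" and T: "1 \<le> horizon I" using I by (auto simp: valid_psba_def l_def)
  have occ: "occupied I e t = {t..<t + l}" for t using l by (auto simp: occupied_def l_def)
  define g where "g t = (\<Sum>i\<in>agents I. agr I i {(e, t)})" for t
  \<comment> \<open>For starts up to \<open>M\<close> the window has
    \<open>min l (horizon I)\<close> slots whether or not the event fits, so total agreement is a
    constant minus the load.\<close>
  have sum: "g t' + load (agent_jobs I) l t' = card (agents I) * min l (horizon I)" if "1 \<le> t'" "t' \<le> M" for t'
  proof -
    have "slots I \<inter> {t'..<t' + l} = {t'..<t' + min l (horizon I)}"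
      using that T by (auto simp: slots_def M_def max_def split: if_splits)
    then have "agr I i {(e, t')} + forced (agent_jobs I ! i) l t' = min l (horizon I)" if "i \<in> agents I" for i
      using agr_add_forced[OF I(1) that I(2), of t'] by (simp add: l_def)
    then have "(\<Sum>i\<in>agents I. agr I i {(e, t')} + forced (agent_jobs I ! i) l t') = (\<Sum>i\<in>agents I. min l (horizon I))"
      by (intro sum.cong) auto
    then show ?thesis by (simp add: g_def load_def agents_def sum.distrib)
  qed
  have "g t' \<le> g t" if "t' \<in> slots I" for t'
  proof -
    \<comment> \<open>Moving a late event back to \<open>M\<close> loses no slot of the
      horizon.\<close>
    define t'' where "t'' = min t' M"
    have t'': "1 \<le> t''" "t'' \<le> M" using that by (auto simp: t''_def M_def slots_def)
    have "slots I \<inter> occupied I e t' \<subseteq> occupied I e t''"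
      using that unfolding occ by (auto simp: t''_def M_def slots_def)
    then have "g t' \<le> g t''" unfolding g_def using agr_mono I by (intro sum_mono) auto
    moreover have "g t'' \<le> g t" using sum[OF t] sum[OF t''] min[OF t''] by simp
    ultimately show ?thesis by simp
  qed
  moreover have "t \<in> slots I" using t T l by (auto simp: slots_def M_def)
  ultimately show ?thesis
    by (auto simp: optimal_position_def is_arg_max_def g_def[symmetric] not_less)
qed

section \<open>Discrete convexity of the load\<close>

lemma overlap_convex:
  assumes "Suc t \<noteq> u" "Suc t + l \<noteq> v + 1"
  shows "2 * overlap l u v (Suc t) \<le> overlap l u v t + overlap l u v (Suc (Suc t))"
  using assms by (auto simp: overlap_def min_def max_def)

lemma excess_convex:
  assumes "Suc t \<noteq> u" "Suc t + l \<noteq> v + 1"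
  shows "2 * excess js l u v (Suc t) \<le> excess js l u v t + excess js l u v (Suc (Suc t))"
  using overlap_convex[OF assms] by (simp add: excess_def)

text \<open>\<open>f\<close>, \<open>g\<close>, \<open>h\<close> are the values at the midpoint and
  at its two neighbours. At an index maximising \<open>f\<close>, the maxima of \<open>g\<close> and
  \<open>h\<close> are at least the values there.\<close>

lemma max_below_convex:
  assumes "\<And>k. k < n \<Longrightarrow> 2 * f k \<le> g k + h k"
  shows "2 * max_below f n \<le> max_below g n + max_below h n"
  using assms
proof (induction n)
  case (Suc n)
  then have "2 * f n \<le> g n + h n" "2 * max_below f n \<le> max_below g n + max_below h n" by simp_all
  then show ?case by simp
qed simp

lemma load_convex:
  assumes "\<And>js j. js \<in> set jss \<Longrightarrow> j \<in> set js \<Longrightarrow> Suc t \<noteq> release j \<and> Suc t + l \<noteq> deadline j + 1"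
  shows "2 * load jss l (Suc t) \<le> load jss l t + load jss l (Suc (Suc t))"
proof -
  have "2 * forced js l (Suc t) \<le> forced js l t + forced js l (Suc (Suc t))" if "js \<in> set jss" for js
    unfolding forced_def using assms[OF that] by (intro max_below_convex excess_convex) auto
  then have "(\<Sum>i<length jss. 2 * forced (jss ! i) l (Suc t)) \<le>
      (\<Sum>i<length jss. forced (jss ! i) l t + forced (jss ! i) l (Suc (Suc t)))"
    by (intro sum_mono) simp
  then show ?thesis by (simp add: load_def sum.distrib sum_distrib_left)
qed

text \<open>Only midpoints strictly inside \<open>{p..q}\<close> are tested, so the ends themselves
  may be exceptional points.\<close>

definition convex_between :: "(nat \<Rightarrow> nat) \<Rightarrow> nat \<Rightarrow> nat \<Rightarrow> bool" where
  "convex_between f p q \<longleftrightarrow> (\<forall>t. p \<le> t \<and> Suc (Suc t) \<le> q \<longrightarrow> 2 * f (Suc t) \<le> f t + f (Suc (Suc t)))"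

text \<open>Differences never decrease, so a strict descent at \<open>m\<close> extends down to
  \<open>p\<close>: discarding everything up to \<open>m\<close> loses no minimum.\<close>

lemma convex_decreasing:
  assumes "convex_between f p q" "f (Suc m) < f m" "Suc m \<le> q" "p \<le> x" "x \<le> m"
  shows "f (Suc m) \<le> f x"
proof -
  have "f (Suc i) < f i" if "p \<le> i" "i \<le> m" for i
    using that(2,1)
  proof (induction i rule: inc_induct)
    case (step i)
    then have "2 * f (Suc i) \<le> f i + f (Suc (Suc i))"
      using assms(1,3) by (auto simp: convex_between_def)
    then show ?case using step by simp
  qed (use assms in simp)
  note dec = this
  have "f m \<le> f x" using assms(5,4)
  proof (induction x rule: inc_induct)
    case (step x)
    then show ?case using dec[of x] by simp
  qed simp
  then show ?thesis using assms(2) by simp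
qed

text \<open>The mirror image, with a weak inequality: on a tie the part right of \<open>m\<close>
  can be discarded.\<close>

lemma convex_increasing:
  assumes "convex_between f p q" "f m \<le> f (Suc m)" "p \<le> m" "Suc m \<le> x" "x \<le> q"
  shows "f m \<le> f x"
proof -
  have inc: "f i \<le> f (Suc i)" if "m \<le> i" "Suc i \<le> q" for i
    using that
  proof (induction i rule: dec_induct)
    case (step i)
    then have "2 * f (Suc i) \<le> f i + f (Suc (Suc i))"
      using assms(1,3) by (auto simp: convex_between_def)
    then show ?case using step by simp
  qed (use assms in simp)
  have "m \<le> x" using assms(4) by simp
  then show ?thesis using assms(5)
  proof (induction x rule: dec_induct)
    case (step x)
    then show ?case using inc[of x] by simp
  qed simp
qed

section \<open>Bounded runs of the machine\<close>

definition cell :: "nat list \<Rightarrow> nat \<Rightarrow> nat" where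
  "cell xs k = (if k < length xs then xs ! k else 0)"

lemma val_Input [simp]: "val xs m (Input a) = cell xs (val xs m a)"
  by (simp add: cell_def Let_def)

declare val.simps(2) [simp del]

text \<open>Bounds the number of nodes and also the exponent of \<open>V\<close> that bounds the
  value. A constant \<open>n\<close> gets \<open>n + 1\<close> because \<open>n < 2 ^ n\<close> and
  \<open>2 \<le> V\<close>.\<close>

primrec width :: "exp \<Rightarrow> nat" where
  "width (Const n) = n + 1"
| "width (Input a) = width a + 1"
| "width (Mem a) = width a + 1"
| "width (Add a b) = width a + width b + 1"
| "width (Sub a b) = width a + width b + 1"
| "width (Mul a b) = width a + width b + 1"
| "width (Div a b) = width a + width b + 1"

lemma width_pos: "1 \<le> width e"
  by (cases e) auto

lemma num_bits_le: "n < 2 ^ b \<Longrightarrow> 1 \<le> b \<Longrightarrow> num_bits n \<le> b"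
  unfolding num_bits_def by (simp add: floorlog_leI)

lemma less_two_power_num_bits: "n < 2 ^ num_bits n"
proof -
  have "n < 2 ^ floorlog 2 n" using floorlog_bounds[of n 2] by (cases "n = 0") auto
  also have "\<dots> \<le> 2 ^ num_bits n" by (simp add: num_bits_def)
  finally show ?thesis .
qed

lemma num_bits_ge_1: "1 \<le> num_bits n"
  by (simp add: num_bits_def)

lemma num_bits_power_le:
  assumes "1 \<le> w" "n \<le> V ^ w"
  shows "num_bits n \<le> w * num_bits V"
proof (rule num_bits_le)
  have "V ^ w < (2 ^ num_bits V) ^ w"
    using assms less_two_power_num_bits[of V] by (intro power_strict_mono) auto
  then show "n < 2 ^ (w * num_bits V)"
    using assms by (simp add: power_mult[symmetric] mult.commute)
  show "1 \<le> w * num_bits V" using assms num_bits_ge_1[of V] by (metis mult_le_mono nat_mult_1)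
qed

text \<open>The square of \<open>1000\<close>, which exceeds the width of all expressions in the program below.\<close>

definition unit_cost :: nat where
  "unit_cost = 1000000"

locale bounded_ram =
  fixes xs :: "nat list" and V :: nat
  assumes two_le_V: "2 \<le> V"
    and input_le_V: "\<And>x. x \<in> set xs \<Longrightarrow> x \<le> V"
begin

lemma cell_le_V: "cell xs k \<le> V"
  using input_le_V by (simp add: cell_def)

lemma val_le_power: "(\<And>k. m k \<le> V) \<Longrightarrow> val xs m e \<le> V ^ width e"
proof (induction e)
  case (Const n)
  have "n < 2 ^ n" by (rule less_exp)
  also have "(2::nat) ^ n \<le> V ^ n" using two_le_V by (rule power_mono) simp
  also have "\<dots> \<le> V ^ (n + 1)" using two_le_V by (intro power_increasing) auto
  finally show ?case by simp
next
  case (Input e)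
  have "val xs m (Input e) \<le> V" using cell_le_V[of "val xs m e"] by simp
  also have "V \<le> V ^ width (Input e)" using two_le_V power_increasing[of 1 "width (Input e)" V] by simp
  finally show ?case .
next
  case (Mem e)
  have "val xs m (Mem e) \<le> V" using Mem.prems[of "val xs m e"] by simp
  also have "V \<le> V ^ width (Mem e)" using two_le_V power_increasing[of 1 "width (Mem e)" V] by simp
  finally show ?case .
next
  case (Add a b)
  have "V ^ width a \<le> V ^ (width a + width b)" "V ^ width b \<le> V ^ (width a + width b)"
    using two_le_V by (auto intro!: power_increasing)
  then have "val xs m (Add a b) \<le> 2 * V ^ (width a + width b)" using Add by simp
  also have "\<dots> \<le> V * V ^ (width a + width b)" using two_le_V by simp
  finally show ?case by simp
next
  case (Sub a b)
  have "V ^ width a \<le> V ^ width (Sub a b)" using two_le_V by (intro power_increasing) auto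
  then show ?case using Sub.IH(1)[OF Sub.prems] by simp
next
  case (Mul a b)
  have "val xs m (Mul a b) \<le> V ^ width a * V ^ width b" using Mul by (simp add: mult_le_mono)
  also have "\<dots> \<le> V ^ width (Mul a b)"
    using two_le_V by (subst power_add[symmetric]) (auto intro!: power_increasing)
  finally show ?case .
next
  case (Div a b)
  have "val xs m (Div a b) \<le> val xs m a" by simp
  also have "\<dots> \<le> V ^ width a" by (rule Div.IH(1)[OF Div.prems])
  also have "\<dots> \<le> V ^ width (Div a b)" using two_le_V by (intro power_increasing) auto
  finally show ?case .
qed

text \<open>At most \<open>width e\<close> nodes are charged at most
  \<open>width e * num_bits V\<close> each; inductively, \<open>a\<^sup>2 + b\<^sup>2 + (a + b + 1)
  \<le> (a + b + 1)\<^sup>2\<close>.\<close>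

lemma cost_le: "(\<And>k. m k \<le> V) \<Longrightarrow> cost xs m e \<le> (width e)\<^sup>2 * num_bits V"
proof (induction e)
  case (Const n)
  have "num_bits n \<le> n + 1" by (rule num_bits_le) (auto intro: less_le_trans[OF less_exp])
  also have "\<dots> = (n + 1) * 1 * 1" by simp
  also have "\<dots> \<le> (n + 1) * (n + 1) * num_bits V"
    by (intro mult_le_mono num_bits_ge_1) simp_all
  also have "\<dots> = (n + 1)\<^sup>2 * num_bits V" by (simp only: power2_eq_square)
  finally show ?case by simp
next
  case (Input a)
  have "num_bits (val xs m (Input a)) \<le> width (Input a) * num_bits V"
    by (rule num_bits_power_le[OF width_pos val_le_power[OF Input.prems]])
  then show ?case using Input by (simp add: power2_eq_square algebra_simps)
next
  case (Mem a)
  have "num_bits (val xs m (Mem a)) \<le> width (Mem a) * num_bits V"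
    by (rule num_bits_power_le[OF width_pos val_le_power[OF Mem.prems]])
  then show ?case using Mem by (simp add: power2_eq_square algebra_simps)
next
  case (Add a b)
  have "num_bits (val xs m (Add a b)) \<le> width (Add a b) * num_bits V"
    by (rule num_bits_power_le[OF width_pos val_le_power[OF Add.prems]])
  then show ?case using Add by (simp add: power2_eq_square algebra_simps)
next
  case (Sub a b)
  have "num_bits (val xs m (Sub a b)) \<le> width (Sub a b) * num_bits V"
    by (rule num_bits_power_le[OF width_pos val_le_power[OF Sub.prems]])
  then show ?case using Sub by (simp add: power2_eq_square algebra_simps)
next
  case (Mul a b)
  have "num_bits (val xs m (Mul a b)) \<le> width (Mul a b) * num_bits V"
    by (rule num_bits_power_le[OF width_pos val_le_power[OF Mul.prems]])
  then show ?case using Mul by (simp add: power2_eq_square algebra_simps)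
next
  case (Div a b)
  have "num_bits (val xs m (Div a b)) \<le> width (Div a b) * num_bits V"
    by (rule num_bits_power_le[OF width_pos val_le_power[OF Div.prems]])
  then show ?case using Div by (simp add: power2_eq_square algebra_simps)
qed

lemma cost_le_unit:
  assumes "\<And>k. m k \<le> V" "width e \<le> 1000"
  shows "cost xs m e \<le> unit_cost * num_bits V"
proof -
  have "(width e)\<^sup>2 \<le> 1000\<^sup>2" using assms(2) by (rule power_mono) simp
  then have "(width e)\<^sup>2 * num_bits V \<le> unit_cost * num_bits V"
    by (intro mult_right_mono) (auto simp: unit_cost_def)
  then show ?thesis using cost_le[OF assms(1)] by (rule order_trans[rotated])
qed

text \<open>
  The budget \<open>N\<close> counts assignments and guards; each of them is charged \<open>unit_cost * num_bits V\<close>,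
  which is sound because no memory cell ever exceeds \<open>V\<close>.
\<close>

definition wp :: "com \<Rightarrow> (nat \<Rightarrow> nat) \<Rightarrow> nat \<Rightarrow> ((nat \<Rightarrow> nat) \<Rightarrow> bool) \<Rightarrow> bool" where
  "wp c m N Q \<longleftrightarrow> ((\<forall>k. m k \<le> V) \<longrightarrow>
     (\<exists>n m'. run xs c m n m' \<and> n \<le> N * (unit_cost * num_bits V) \<and> (\<forall>k. m' k \<le> V) \<and> Q m'))"

lemma wp_mono:
  assumes "wp c m N Q" "N \<le> N'" "\<And>m'. Q m' \<Longrightarrow> Q' m'"
  shows "wp c m N' Q'"
  using assms mult_le_mono1[OF assms(2), of "unit_cost * num_bits V"]
  unfolding wp_def by (meson order_trans)

lemma wp_Skip: "Q m \<Longrightarrow> wp Skip m 1 Q"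
proof -
  have "1 * 1 \<le> unit_cost * num_bits V"
    using num_bits_ge_1[of V] by (intro mult_le_mono) (auto simp: unit_cost_def)
  then show "Q m \<Longrightarrow> wp Skip m 1 Q" unfolding wp_def by (auto intro!: exI run.Skip)
qed

lemma wp_Store:
  assumes "val xs m e \<le> V" "x + width e \<le> 998" "Q (m(x := val xs m e))"
  shows "wp (Store (Const x) e) m 1 Q"
  unfolding wp_def
proof
  assume m: "\<forall>k. m k \<le> V"
  \<comment> \<open>A fictitious sum dominates address and value together, so one unit pays for
    both; its width \<open>x + width e + 2\<close> accounts for the bound 998.\<close>
  have "cost xs m (Const x) + cost xs m e \<le> cost xs m (Add (Const x) e)" by simp
  also have "\<dots> \<le> unit_cost * num_bits V" using m assms(2) by (intro cost_le_unit) auto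
  finally have "cost xs m (Const x) + cost xs m e \<le> unit_cost * num_bits V" .
  moreover have "run xs (Store (Const x) e) m (cost xs m (Const x) + cost xs m e) (m(x := val xs m e))"
    using run.Store[of xs "Const x" e m] by simp
  moreover have "\<forall>k. (m(x := val xs m e)) k \<le> V" using m assms(1) by simp
  ultimately show "\<exists>n m'. run xs (Store (Const x) e) m n m' \<and> n \<le> 1 * (unit_cost * num_bits V) \<and>
      (\<forall>k. m' k \<le> V) \<and> Q m'"
    using assms(3) by (metis nat_mult_1)
qed

lemma wp_Seq:
  assumes "wp c1 m N1 (\<lambda>m'. wp c2 m' N2 Q)"
  shows "wp (Seq c1 c2) m (N1 + N2) Q"
  unfolding wp_def
proof
  assume "\<forall>k. m k \<le> V"
  then obtain n1 m1 where 1: "run xs c1 m n1 m1" "n1 \<le> N1 * (unit_cost * num_bits V)"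
    "\<forall>k. m1 k \<le> V" "wp c2 m1 N2 Q"
    using assms by (auto simp: wp_def)
  then obtain n2 m2 where 2: "run xs c2 m1 n2 m2" "n2 \<le> N2 * (unit_cost * num_bits V)"
    "\<forall>k. m2 k \<le> V" "Q m2"
    by (auto simp: wp_def)
  have "run xs (Seq c1 c2) m (n1 + n2) m2" using 1 2 by (intro run.Seq)
  moreover have "n1 + n2 \<le> (N1 + N2) * (unit_cost * num_bits V)" using 1 2 by (simp add: add_mult_distrib)
  ultimately show "\<exists>n m'. run xs (Seq c1 c2) m n m' \<and> n \<le> (N1 + N2) * (unit_cost * num_bits V) \<and>
      (\<forall>k. m' k \<le> V) \<and> Q m'"
    using 2 by blast
qed

lemma wp_Cond:
  assumes "val xs m b \<noteq> 0 \<Longrightarrow> wp c1 m N Q" "val xs m b = 0 \<Longrightarrow> wp c2 m N Q" "width b \<le> 1000"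
  shows "wp (Cond b c1 c2) m (1 + N) Q"
  unfolding wp_def
proof
  assume m: "\<forall>k. m k \<le> V"
  have b: "cost xs m b \<le> unit_cost * num_bits V" using m assms(3) by (intro cost_le_unit) auto
  obtain n m' where "run xs (if val xs m b \<noteq> 0 then c1 else c2) m n m'"
    and 1: "n \<le> N * (unit_cost * num_bits V)" "\<forall>k. m' k \<le> V" "Q m'"
    using assms(1,2) m by (cases "val xs m b = 0") (auto simp: wp_def)
  then have "run xs (Cond b c1 c2) m (cost xs m b + n) m'"
    by (auto intro: run.CondTrue run.CondFalse split: if_splits)
  moreover have "cost xs m b + n \<le> (1 + N) * (unit_cost * num_bits V)" using 1 b by simp
  ultimately show "\<exists>n m'. run xs (Cond b c1 c2) m n m' \<and> n \<le> (1 + N) * (unit_cost * num_bits V) \<and>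
      (\<forall>k. m' k \<le> V) \<and> Q m'"
    using 1 by blast
qed

lemma wp_While:
  assumes step: "\<And>m. I m \<Longrightarrow> val xs m b \<noteq> 0 \<Longrightarrow> wp c m N (\<lambda>m'. I m' \<and> \<mu> m' < \<mu> m)"
    and "width b \<le> 1000" and "I m"
  shows "wp (While b c) m (\<mu> m * (N + 1) + 1) (\<lambda>m'. I m' \<and> val xs m' b = 0)"
  using assms(3)
proof (induction "\<mu> m" arbitrary: m rule: less_induct)
  case less
  let ?u = "unit_cost * num_bits V"
  show ?case
    unfolding wp_def
  proof
    assume m: "\<forall>k. m k \<le> V"
    have b: "cost xs m b \<le> ?u" using m assms(2) by (intro cost_le_unit) auto
    show "\<exists>n m'. run xs (While b c) m n m' \<and> n \<le> (\<mu> m * (N + 1) + 1) * ?u \<and>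
      (\<forall>k. m' k \<le> V) \<and> I m' \<and> val xs m' b = 0"
    proof (cases "val xs m b = 0")
      case True
      then have "run xs (While b c) m (cost xs m b) m" by (rule run.WhileFalse)
      moreover have "cost xs m b \<le> (\<mu> m * (N + 1) + 1) * ?u" using b by simp
      ultimately show ?thesis using m less.prems True by blast
    next
      case False
      then obtain n1 m1 where 1: "run xs c m n1 m1" "n1 \<le> N * ?u" "\<forall>k. m1 k \<le> V" "I m1" "\<mu> m1 < \<mu> m"
        using step[OF less.prems] m by (auto simp: wp_def)
      then obtain n2 m2 where 2: "run xs (While b c) m1 n2 m2" "n2 \<le> (\<mu> m1 * (N + 1) + 1) * ?u"
          "\<forall>k. m2 k \<le> V" "I m2" "val xs m2 b = 0"
        using less.hyps[of m1] by (auto simp: wp_def)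
      have "run xs (While b c) m (cost xs m b + n1 + n2) m2"
        using False 1 2 by (intro run.WhileTrue)
      moreover have "cost xs m b + n1 + n2 \<le> (1 + N + (\<mu> m1 * (N + 1) + 1)) * ?u"
        using b 1(2) 2(2) by (simp add: add_mult_distrib)
      moreover have "1 + N + (\<mu> m1 * (N + 1) + 1) \<le> \<mu> m * (N + 1) + 1"
        using mult_le_mono1[of "Suc (\<mu> m1)" "\<mu> m" "N + 1"] 1(5) by simp
      ultimately show ?thesis using 2 by (meson mult_le_mono1 order_trans)
    qed
  qed
qed

end

definition For :: "nat \<Rightarrow> exp \<Rightarrow> com \<Rightarrow> com" where
  "For i e c = Seq (Store (Const i) (Const 0))
     (While (Sub e (Mem (Const i))) (Seq c (Store (Const i) (Add (Mem (Const i)) (Const 1)))))"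

text \<open>\<open>H\<close> bounds the number \<open>h\<close> of iterations uniformly, so nested
  loops over lists of different lengths share one budget. The invariant after the body speaks of the
  advanced counter, since the increment is left to \<open>For\<close>.\<close>

lemma (in bounded_ram) wp_For:
  assumes init: "Inv 0 (m(i := 0))"
    and bound: "\<And>j m. Inv j m \<Longrightarrow> val xs m e = h"
    and step: "\<And>j m. j < h \<Longrightarrow> Inv j m \<Longrightarrow> m i = j \<Longrightarrow> wp c m N (\<lambda>m'. m' i = j \<and> Inv (Suc j) (m'(i := Suc j)))"
    and "h \<le> V" "h \<le> H" and width: "width e + i \<le> 990" "2 * i \<le> 990"
  shows "wp (For i e c) m (H * (N + 2) + 2) (\<lambda>m'. m' i = h \<and> Inv h m')"
proof -
  let ?I = "\<lambda>m. Inv (m i) m \<and> m i \<le> h" and ?\<mu> = "\<lambda>m. h - m i"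
  let ?b = "Sub e (Mem (Const i))" and ?c = "Seq c (Store (Const i) (Add (Mem (Const i)) (Const 1)))"
  have W: "wp (While ?b ?c) m (?\<mu> m * (N + 1 + 1) + 1) (\<lambda>m'. ?I m' \<and> val xs m' ?b = 0)"
    if "?I m" for m
  proof (rule wp_While)
    show "wp ?c m (N + 1) (\<lambda>m'. ?I m' \<and> ?\<mu> m' < ?\<mu> m)" if "?I m" "val xs m ?b \<noteq> 0" for m
    proof (rule wp_Seq)
      have lt: "m i < h" using that bound[of "m i" m] by auto
      show "wp c m N (\<lambda>m'. wp (Store (Const i) (Add (Mem (Const i)) (Const 1))) m' 1 (\<lambda>m'. ?I m' \<and> ?\<mu> m' < ?\<mu> m))"
      proof (rule wp_mono[OF step[of "m i" m] order.refl])
        fix m' assume "m' i = m i \<and> Inv (Suc (m i)) (m'(i := Suc (m i)))"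
        then show "wp (Store (Const i) (Add (Mem (Const i)) (Const 1))) m' 1 (\<lambda>m'. ?I m' \<and> ?\<mu> m' < ?\<mu> m)"
          using lt \<open>h \<le> V\<close> width by (intro wp_Store) auto
      qed (use lt that in auto)
    qed
  qed (use width that in auto)
  have "wp (For i e c) m (1 + (h * (N + 1 + 1) + 1)) (\<lambda>m'. m' i = h \<and> Inv h m')"
    unfolding For_def
  proof (intro wp_Seq wp_Store)
    show "wp (While ?b ?c) (m(i := val xs m (Const 0))) (h * (N + 1 + 1) + 1) (\<lambda>m'. m' i = h \<and> Inv h m')"
      by (rule wp_mono[OF W]) (use init bound in auto)
  qed (use width in auto)
  then show ?thesis
    by (rule wp_mono) (use \<open>h \<le> H\<close> mult_le_mono1[of h H "N + 2"] in auto)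
qed

section \<open>The program\<close>

abbreviation (input) Var :: "nat \<Rightarrow> exp" where
  "Var k \<equiv> Mem (Const k)"

abbreviation (input) Set :: "nat \<Rightarrow> exp \<Rightarrow> com" where
  "Set k e \<equiv> Store (Const k) e"

text \<open>Truncated subtraction provides minimum, maximum and comparisons inside expressions,
  without branching.\<close>

definition Min_exp :: "exp \<Rightarrow> exp \<Rightarrow> exp" where
  "Min_exp a b = Sub a (Sub a b)"

definition Max_exp :: "exp \<Rightarrow> exp \<Rightarrow> exp" where
  "Max_exp a b = Add a (Sub b a)"

lemma Min_exp_simps [simp]:
  "val xs m (Min_exp a b) = min (val xs m a) (val xs m b)"
  "width (Min_exp a b) = 2 * width a + width b + 2"
  by (simp_all add: Min_exp_def)

lemma Max_exp_simps [simp]: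
  "val xs m (Max_exp a b) = max (val xs m a) (val xs m b)"
  "width (Max_exp a b) = 2 * width a + width b + 2"
  by (simp_all add: Max_exp_def)

text \<open>Cell \<open>p\<close> itself holds the number of jobs, so the entries of job
  \<open>k\<close> are addressed by \<open>c\<close> = 1, 2, 3.\<close>

definition field :: "nat list \<Rightarrow> nat \<Rightarrow> nat \<Rightarrow> nat \<Rightarrow> nat" where
  "field xs p k c = cell xs (p + (3 * k + c))"

definition Field_exp :: "nat \<Rightarrow> nat \<Rightarrow> exp" where
  "Field_exp x c = Input (Add (Var 10) (Add (Mul (Const 3) (Var x)) (Const c)))"

lemma Field_exp_simps [simp]:
  "val xs m (Field_exp x c) = field xs (m 10) (m x) c"
  "width (Field_exp x c) = x + c + 23"
  by (simp_all add: Field_exp_def field_def)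

definition agent_at :: "nat list \<Rightarrow> nat \<Rightarrow> job list \<Rightarrow> bool" where
  "agent_at xs p js \<longleftrightarrow> cell xs p = length js \<and>
     (\<forall>k<length js. field xs p k 1 = release (js ! k) \<and> field xs p k 2 = deadline (js ! k) \<and>
        field xs p k 3 = proc_time (js ! k))"

definition total_proc :: "job list \<Rightarrow> nat" where
  "total_proc js = (\<Sum>k<length js. proc_time (js ! k))"

text \<open>
  Memory layout: 0 best position so far, 1 largest sensible position \<open>M\<close>, 2 a saved load,
  3 number of candidates, 4 and 5 the current pair of candidates, 6 and 7 bounds of the binary
  search, 8 argument and 9 result of \<open>load_com\<close>, 10 input address of the current agent 11,
  12 and 13 jobs giving the release time and the deadline of the current interval, 14 job being
  added to the demand, 15 demand and then excess, 16 forced slots of the agent, 17 midpoint.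
\<close>

definition demand_com :: com where
  "demand_com = Seq (Set 15 (Const 0)) (For 14 (Input (Var 10))
     (Set 15 (Add (Var 15) (Mul (Field_exp 14 3)
        (Sub (Const 1) (Add (Sub (Field_exp 12 1) (Field_exp 14 1)) (Sub (Field_exp 14 2) (Field_exp 13 2))))))))"

definition forced_com :: com where
  "forced_com = Seq (Set 16 (Const 0)) (For 12 (Input (Var 10)) (For 13 (Input (Var 10))
     (Seq demand_com (Seq
       (Set 15 (Sub (Add (Var 15)
            (Sub (Min_exp (Add (Field_exp 13 2) (Const 1)) (Add (Var 8) (Input (Const 2))))
              (Max_exp (Field_exp 12 1) (Var 8))))
          (Sub (Add (Field_exp 13 2) (Const 1)) (Field_exp 12 1))))
       (Set 16 (Max_exp (Var 16) (Var 15)))))))"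

text \<open>Agent records start at cell 4 because a single event gives a header of four cells:
  horizon, 1, length of the event, number of agents.\<close>

definition load_com :: com where
  "load_com = Seq (Set 9 (Const 0)) (Seq (Set 10 (Const 4)) (For 11 (Input (Const 3))
     (Seq forced_com (Seq (Set 9 (Add (Var 9) (Var 16)))
       (Set 10 (Add (Var 10) (Add (Const 1) (Mul (Const 3) (Input (Var 10))))))))))"

text \<open>This and the next two bounds keep the accumulators below \<open>V\<close>, as
  \<open>wp_Store\<close> requires.\<close>

lemma demand_le_total_proc: "demand js u v \<le> total_proc js"
  unfolding demand_def total_proc_def by (rule sum_mono) auto

lemma excess_le_total_proc: "excess js l u v t \<le> total_proc js"
  using demand_le_total_proc[of js u v] overlap_le[of l u v t] by (simp add: excess_def)

lemma forced_le_total_proc: "forced js l t \<le> total_proc js"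
  by (auto simp: forced_def max_below_le_iff excess_le_total_proc)

context bounded_ram
begin

lemma wp_demand:
  assumes at: "agent_at xs (m 10) js" and L: "length js \<le> L" "L \<le> V" and P: "total_proc js \<le> V"
    and k: "m 12 < length js" "m 13 < length js"
  shows "wp demand_com m (3 * L + 3)
    (\<lambda>m'. m' 15 = demand js (release (js ! m 12)) (deadline (js ! m 13)) \<and> (\<forall>x. x \<notin> {14, 15} \<longrightarrow> m' x = m x))"
proof -
  define u v where "u = release (js ! m 12)" and "v = deadline (js ! m 13)"
  let ?f = "\<lambda>k. if u \<le> release (js ! k) \<and> deadline (js ! k) \<le> v then proc_time (js ! k) else 0"
  let ?I = "\<lambda>j m'. m' 15 = (\<Sum>k<j. ?f k) \<and> (\<forall>x. x \<notin> {14, 15} \<longrightarrow> m' x = m x)"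
  note at' = at[unfolded agent_at_def]
  have "wp demand_com m (1 + (L * (1 + 2) + 2)) (\<lambda>m'. m' 14 = length js \<and> ?I (length js) m')"
    unfolding demand_com_def
  proof (intro wp_Seq wp_Store wp_For)
    fix j m' assume j: "j < length js" and I: "?I j m'" and m': "m' 14 = j"
    let ?e = "Add (Var 15) (Mul (Field_exp 14 3)
        (Sub (Const 1) (Add (Sub (Field_exp 12 1) (Field_exp 14 1)) (Sub (Field_exp 14 2) (Field_exp 13 2)))))"
    have e: "val xs m' ?e = (\<Sum>k<Suc j. ?f k)"
      using I m' j at' k by (auto simp: u_def v_def)
    have "(\<Sum>k<Suc j. ?f k) \<le> total_proc js"
      using j unfolding total_proc_def
      by (intro order_trans[OF sum_mono sum_mono2]) auto
    then show "val xs m' ?e \<le> V" unfolding e using P by simp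
    show "(m'(15 := val xs m' ?e)) 14 = j \<and> ?I (Suc j) ((m'(15 := val xs m' ?e))(14 := Suc j))"
      unfolding e using I m' by simp
  qed (use at' L in \<open>auto\<close>)
  then show ?thesis
    by (rule wp_mono) (auto simp: demand_def u_def v_def)
qed

lemma wp_forced:
  assumes at: "agent_at xs (m 10) js" and L: "length js \<le> L" "L \<le> V" and P: "total_proc js \<le> V"
    and l: "cell xs 2 = l"
  shows "wp forced_com m (1 + (L * ((L * ((3 * L + 3 + (1 + 1)) + 2) + 2) + 2) + 2))
    (\<lambda>m'. m' 16 = forced js l (m 8) \<and> (\<forall>x. x \<notin> {12, 13, 14, 15, 16} \<longrightarrow> m' x = m x))"
proof -
  define g where "g = (\<lambda>k k'. excess js l (release (js ! k)) (deadline (js ! k')) (m 8))"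
  define h where "h = (\<lambda>k. max_below (g k) (length js))"
  have g: "g k k' \<le> V" for k k' using excess_le_total_proc P unfolding g_def by (rule order_trans)
  let ?F = "\<lambda>m'. \<forall>x. x \<notin> {12, 13, 14, 15, 16} \<longrightarrow> m' x = m x"
  let ?I = "\<lambda>j m'. m' 16 = max_below h j \<and> ?F m'"
  note at' = at[unfolded agent_at_def]
  have hle: "max_below h j \<le> V" for j by (simp add: max_below_le_iff h_def g)
  have "wp forced_com m (1 + (L * ((L * ((3 * L + 3 + (1 + 1)) + 2) + 2) + 2) + 2))
     (\<lambda>m'. m' 12 = length js \<and> ?I (length js) m')"
    unfolding forced_com_def
  proof (intro wp_Seq wp_Store)
    let ?m0 = "m(16 := val xs m (Const 0))"
    let ?c2 = "Seq demand_com (Seq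
       (Set 15 (Sub (Add (Var 15)
            (Sub (Min_exp (Add (Field_exp 13 2) (Const 1)) (Add (Var 8) (Input (Const 2))))
              (Max_exp (Field_exp 12 1) (Var 8))))
          (Sub (Add (Field_exp 13 2) (Const 1)) (Field_exp 12 1))))
       (Set 16 (Max_exp (Var 16) (Var 15))))"
    show "wp (For 12 (Input (Var 10)) (For 13 (Input (Var 10)) ?c2)) ?m0
        (L * ((L * ((3 * L + 3 + (1 + 1)) + 2) + 2) + 2) + 2) (\<lambda>m'. m' 12 = length js \<and> ?I (length js) m')"
    proof (rule wp_For)
      fix j m1 assume j: "j < length js" and I1: "?I j m1" and m1: "m1 12 = j"
      \<comment> \<open>Within the inner loop, cell 16 holds the finished rows before
        \<open>j\<close> together with the part of row \<open>j\<close> seen so far.\<close>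
      let ?I2 = "\<lambda>i m'. m' 12 = j \<and> m' 16 = max (max_below h j) (max_below (g j) i) \<and> ?F m'"
      have "wp (For 13 (Input (Var 10)) ?c2) m1 (L * ((3 * L + 3 + (1 + 1)) + 2) + 2)
         (\<lambda>m'. m' 13 = length js \<and> ?I2 (length js) m')"
      proof (rule wp_For)
        fix i m2 assume i: "i < length js" and I2: "?I2 i m2" and m2: "m2 13 = i"
        have at2: "agent_at xs (m2 10) js" and k2: "m2 12 < length js" "m2 13 < length js"
          using at I2 i j m2 by auto
        show "wp ?c2 m2 (3 * L + 3 + (1 + 1)) (\<lambda>m'. m' 13 = i \<and> ?I2 (Suc i) (m'(13 := Suc i)))"
        proof (rule wp_Seq, rule wp_mono[OF wp_demand[OF at2 L P k2] order.refl], intro wp_Seq wp_Store)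
          fix m3 assume m3: "m3 15 = demand js (release (js ! m2 12)) (deadline (js ! m2 13)) \<and>
            (\<forall>x. x \<notin> {14, 15} \<longrightarrow> m3 x = m2 x)"
          let ?e = "Sub (Add (Var 15)
            (Sub (Min_exp (Add (Field_exp 13 2) (Const 1)) (Add (Var 8) (Input (Const 2))))
              (Max_exp (Field_exp 12 1) (Var 8))))
          (Sub (Add (Field_exp 13 2) (Const 1)) (Field_exp 12 1))"
          have e: "val xs m3 ?e = g j i"
            using m3 I2 m2 i j at' l by (simp add: g_def excess_def overlap_def)
          show "val xs m3 ?e \<le> V" unfolding e by (rule g)
          let ?m4 = "m3(15 := val xs m3 ?e)"
          have e2: "val xs ?m4 (Max_exp (Var 16) (Var 15)) = max (max_below h j) (max_below (g j) (Suc i))"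
            unfolding e using I2 m3 by simp
          show "val xs ?m4 (Max_exp (Var 16) (Var 15)) \<le> V"
            unfolding e2 using hle[of j] max_below_le_iff[of "g j" "Suc i" V] g by simp
          show "(?m4(16 := val xs ?m4 (Max_exp (Var 16) (Var 15)))) 13 = i \<and>
              ?I2 (Suc i) ((?m4(16 := val xs ?m4 (Max_exp (Var 16) (Var 15))))(13 := Suc i))"
            unfolding e2 using I2 m3 m2 by simp
        qed auto
      qed (use at' L I1 m1 in auto)
      then show "wp (For 13 (Input (Var 10)) ?c2) m1 (L * ((3 * L + 3 + (1 + 1)) + 2) + 2)
         (\<lambda>m'. m' 12 = j \<and> ?I (Suc j) (m'(12 := Suc j)))"
        by (rule wp_mono) (auto simp: h_def)
    qed (use at' L in auto)
  qed auto
  then show ?thesis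
    by (rule wp_mono) (auto simp: forced_def g_def h_def)
qed

end

text \<open>\<open>off i\<close> is the input address of agent \<open>i\<close> and \<open>L\<close>
  the end address. \<open>V\<close> leaves room for positions up to \<open>T + 1\<close>, addresses,
  candidate indices up to \<open>2 * L\<close>, and all demands and loads.\<close>

locale psba_input = bounded_ram xs V for xs V +
  fixes T l L :: nat and jss :: "job list list" and off :: "nat \<Rightarrow> nat"
  assumes cell0: "cell xs 0 = T" and cell1: "cell xs 1 = 1" and cell2: "cell xs 2 = l" and cell3: "cell xs 3 = length jss"
    and off_0: "off 0 = 4"
    and off_Suc: "\<And>i. i < length jss \<Longrightarrow> off (Suc i) = off i + (1 + 3 * length (jss ! i))"
    and off_length: "off (length jss) = L"
    and agent_at: "\<And>i. i < length jss \<Longrightarrow> agent_at xs (off i) (jss ! i)"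
    and V: "T + 2 * L + 10 \<le> V" "(\<Sum>i<length jss. total_proc (jss ! i)) \<le> V"
begin

lemma off_ge: "i \<le> length jss \<Longrightarrow> i + 4 \<le> off i"
  by (induction i) (auto simp: off_0 off_Suc)

lemma off_le: "i \<le> j \<Longrightarrow> j \<le> length jss \<Longrightarrow> off i \<le> off j"
  by (induction j rule: dec_induct) (auto simp: off_Suc)

lemma off_le_L: "i \<le> length jss \<Longrightarrow> off i \<le> L"
  using off_le[of i "length jss"] off_length by simp

lemma lengths_le: "length jss \<le> L" "i < length jss \<Longrightarrow> length (jss ! i) \<le> L"
  using off_ge[of "length jss"] off_length off_le_L[of "Suc i"] off_Suc[of i] by auto

lemma total_proc_le_V: "i < length jss \<Longrightarrow> total_proc (jss ! i) \<le> V"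
  using member_le_sum[of i "{..<length jss}" "\<lambda>i. total_proc (jss ! i)"] V(2) by simp

text \<open>Left unsimplified: this is literally the budget that the \<open>wp\<close> rules
  assemble along \<open>load_com\<close>, so they apply by unification. The other time bounds are
  written in the same way.\<close>

definition load_time :: nat where
  "load_time = 1 + (1 + (L * (1 + (L * ((L * ((3 * L + 3 + (1 + 1)) + 2) + 2) + 2) + 2) + (1 + 1) + 2) + 2))"

lemma wp_load:
  "wp load_com m load_time (\<lambda>m'. m' 9 = load jss l (m 8) \<and> (\<forall>x. x \<notin> {9..16} \<longrightarrow> m' x = m x))"
proof -
  let ?F = "\<lambda>m'. \<forall>x. x \<notin> {9..16} \<longrightarrow> m' x = m x"
  let ?I = "\<lambda>j m'. m' 9 = (\<Sum>i<j. forced (jss ! i) l (m 8)) \<and> m' 10 = off j \<and> ?F m'"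
  have "wp load_com m load_time (\<lambda>m'. m' 11 = length jss \<and> ?I (length jss) m')"
    unfolding load_com_def load_time_def
  proof (intro wp_Seq wp_Store)
    show "wp (For 11 (Input (Const 3))
     (Seq forced_com (Seq (Set 9 (Add (Var 9) (Var 16)))
       (Set 10 (Add (Var 10) (Add (Const 1) (Mul (Const 3) (Input (Var 10)))))))))
       (m(9 := val xs m (Const 0), 10 := val xs (m(9 := val xs m (Const 0))) (Const 4)))
       (L * (1 + (L * ((L * ((3 * L + 3 + (1 + 1)) + 2) + 2) + 2) + 2) + (1 + 1) + 2) + 2)
       (\<lambda>m'. m' 11 = length jss \<and> ?I (length jss) m')"
    proof (rule wp_For)
      fix j m1 assume j: "j < length jss" and I1: "?I j m1" and m1: "m1 11 = j"
      have at: "agent_at xs (m1 10) (jss ! j)" using agent_at j I1 by simp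
      have LV: "L \<le> V" using V by simp
      show "wp (Seq forced_com (Seq (Set 9 (Add (Var 9) (Var 16)))
       (Set 10 (Add (Var 10) (Add (Const 1) (Mul (Const 3) (Input (Var 10)))))))) m1
        (1 + (L * ((L * ((3 * L + 3 + (1 + 1)) + 2) + 2) + 2) + 2) + (1 + 1))
        (\<lambda>m'. m' 11 = j \<and> ?I (Suc j) (m'(11 := Suc j)))"
      proof (rule wp_Seq, rule wp_mono[OF wp_forced[where m = m1, OF at lengths_le(2)[OF j] LV total_proc_le_V[OF j] cell2] order.refl],
          intro wp_Seq wp_Store)
        fix m2 assume m2: "m2 16 = forced (jss ! j) l (m1 8) \<and>
          (\<forall>x. x \<notin> {12, 13, 14, 15, 16} \<longrightarrow> m2 x = m1 x)"
        have e: "val xs m2 (Add (Var 9) (Var 16)) = (\<Sum>i<Suc j. forced (jss ! i) l (m 8))"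
          using m2 I1 by simp
        have "(\<Sum>i<Suc j. forced (jss ! i) l (m 8)) \<le> (\<Sum>i<length jss. total_proc (jss ! i))"
          using j by (intro order_trans[OF sum_mono[OF forced_le_total_proc] sum_mono2]) auto
        then show "val xs m2 (Add (Var 9) (Var 16)) \<le> V" unfolding e using V by simp
        let ?m3 = "m2(9 := val xs m2 (Add (Var 9) (Var 16)))"
        let ?e2 = "Add (Var 10) (Add (Const 1) (Mul (Const 3) (Input (Var 10))))"
        have e2: "val xs ?m3 ?e2 = off (Suc j)"
          using m2 I1 off_Suc[OF j] agent_at[OF j] by (simp add: agent_at_def)
        show "val xs ?m3 ?e2 \<le> V" unfolding e2 using off_le_L[of "Suc j"] j V by simp
        show "(?m3(10 := val xs ?m3 ?e2)) 11 = j \<and> ?I (Suc j) ((?m3(10 := val xs ?m3 ?e2))(11 := Suc j))"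
          unfolding e2 unfolding e using I1 m1 m2 by auto
      qed auto
    qed (use V off_0 cell3 lengths_le in auto)
  qed (use V in auto)
  then show ?thesis
    by (rule wp_mono) (auto simp: load_def)
qed

lemma load_le_V: "load jss l t \<le> V"
  unfolding load_def using V(2) by (rule order_trans[OF sum_mono[OF forced_le_total_proc]])

end

section \<open>Binary search over pairs of candidates\<close>

definition search_com :: com where
  "search_com = While (Sub (Var 7) (Var 6))
     (Seq (Set 17 (Div (Add (Var 6) (Var 7)) (Const 2)))
     (Seq (Set 8 (Var 17)) (Seq load_com (Seq (Set 2 (Var 9))
     (Seq (Set 8 (Add (Var 17) (Const 1))) (Seq load_com
     (Cond (Sub (Var 2) (Var 9)) (Set 6 (Add (Var 17) (Const 1))) (Set 7 (Var 17)))))))))"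

definition update_com :: com where
  "update_com = Seq (Set 8 (Var 0)) (Seq load_com (Seq (Set 2 (Var 9))
     (Seq (Set 8 (Var 6)) (Seq load_com
     (Cond (Sub (Var 2) (Var 9)) (Set 0 (Var 6)) Skip)))))"

text \<open>
  The candidate positions are all numbers \<open>x\<close> and \<open>x + 1 - l\<close> for input cells \<open>x\<close>, clipped to
  \<open>{1..M}\<close>; an even or odd value of cell \<open>a\<close> selects the first or the second kind. They include \<open>1\<close>, \<open>M\<close>
  and all points where the load can fail to be convex, and superfluous candidates do no harm.
\<close>

definition Cand_exp :: "nat \<Rightarrow> exp" where
  "Cand_exp a = Max_exp (Const 1) (Min_exp (Var 1)
     (Sub (Add (Input (Div (Var a) (Const 2))) (Sub (Var a) (Mul (Const 2) (Div (Var a) (Const 2)))))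
        (Mul (Input (Const 2)) (Sub (Var a) (Mul (Const 2) (Div (Var a) (Const 2)))))))"

text \<open>The machine has no access to the length of its input. The first loop walks along the
  agent records to the end address, which is that length, and thus finds the number of
  candidates.\<close>

definition main_com :: com where
  "main_com = Seq (Set 1 (Max_exp (Const 1) (Sub (Add (Input (Const 0)) (Const 1)) (Input (Const 2)))))
     (Seq (Set 3 (Const 4))
     (Seq (For 4 (Input (Const 3)) (Set 3 (Add (Var 3) (Add (Const 1) (Mul (Const 3) (Input (Var 3)))))))
     (Seq (Set 3 (Mul (Const 2) (Var 3)))
     (Seq (Set 0 (Const 1))
     (For 4 (Var 3) (For 5 (Var 3)
       (Seq (Set 6 (Cand_exp 4)) (Seq (Set 7 (Cand_exp 5)) (Seq search_com update_com)))))))))"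

lemma floorlog_2_div_2: "0 < d \<Longrightarrow> floorlog 2 (d div 2) < floorlog 2 d"
  by (subst (2) compute_floorlog) simp

text \<open>The invariant of the search: each position of \<open>{p..q}\<close> is matched by one in
  the current range that is no worse.\<close>

lemma convex_search_step:
  assumes conv: "convex_between f p q" and pq: "p \<le> lo" "lo < hi" "hi \<le> q"
    and min: "\<forall>x\<in>{p..q}. \<exists>y\<in>{lo..hi}. f y \<le> f x"
  defines "mid \<equiv> (lo + hi) div 2"
  shows "f (Suc mid) < f mid \<Longrightarrow> \<forall>x\<in>{p..q}. \<exists>y\<in>{Suc mid..hi}. f y \<le> f x"
    and "f mid \<le> f (Suc mid) \<Longrightarrow> \<forall>x\<in>{p..q}. \<exists>y\<in>{lo..mid}. f y \<le> f x"
proof -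
  have mid: "lo \<le> mid" "mid < hi" using pq by (auto simp: mid_def)
  show "\<forall>x\<in>{p..q}. \<exists>y\<in>{Suc mid..hi}. f y \<le> f x" if lt: "f (Suc mid) < f mid"
  proof
    fix x assume "x \<in> {p..q}"
    then obtain y where y: "y \<in> {lo..hi}" "f y \<le> f x" using min by blast
    show "\<exists>y\<in>{Suc mid..hi}. f y \<le> f x"
    proof (cases "y \<le> mid")
      case True
      then have "f (Suc mid) \<le> f y" using y pq mid by (intro convex_decreasing[OF conv lt]) auto
      then show ?thesis using y mid by (intro bexI[of _ "Suc mid"]) auto
    next
      case False
      then show ?thesis using y by auto
    qed
  qed
  show "\<forall>x\<in>{p..q}. \<exists>y\<in>{lo..mid}. f y \<le> f x" if le: "f mid \<le> f (Suc mid)"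
  proof
    fix x assume "x \<in> {p..q}"
    then obtain y where y: "y \<in> {lo..hi}" "f y \<le> f x" using min by blast
    show "\<exists>y\<in>{lo..mid}. f y \<le> f x"
    proof (cases "y \<le> mid")
      case True
      then show ?thesis using y by auto
    next
      case False
      then have "f mid \<le> f y" using y pq mid by (intro convex_increasing[OF conv le]) auto
      then show ?thesis using y mid by (intro bexI[of _ mid]) auto
    qed
  qed
qed

context psba_input
begin

definition M :: nat where
  "M = max 1 (T + 1 - l)"

definition cand :: "nat \<Rightarrow> nat" where
  "cand a = max 1 (min M (cell xs (a div 2) + a mod 2 - l * (a mod 2)))"

lemma M_bounds: "1 \<le> M" "M \<le> V"
  using V by (auto simp: M_def)

lemma cand_bounds: "1 \<le> cand a" "cand a \<le> M"
  using M_bounds by (auto simp: cand_def)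

lemma Cand_exp_simps: "m 1 = M \<Longrightarrow> val xs m (Cand_exp a) = cand (m a)" "a \<le> 5 \<Longrightarrow> width (Cand_exp a) \<le> 900"
  by (auto simp: Cand_exp_def cand_def cell2 modulo_nat_def mult.commute)

abbreviation (input) cost_fun :: "nat \<Rightarrow> nat" where
  "cost_fun \<equiv> load jss l"

definition search_time :: nat where
  "search_time = floorlog 2 M * (1 + (1 + (load_time + (1 + (1 + (load_time + (1 + 1)))))) + 1) + 1"

text \<open>Staying within \<open>{1..M}\<close> is unconditional, as the search also runs on pairs
  without convexity. On a reversed pair the loop body is never entered and the optimality claim is
  about an empty range.\<close>

lemma wp_search:
  assumes "1 \<le> m 6" "m 6 \<le> M" "1 \<le> m 7" "m 7 \<le> M"
  shows "wp search_com m search_time (\<lambda>m'. 1 \<le> m' 6 \<and> m' 6 \<le> M \<and>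
     (convex_between cost_fun (m 6) (m 7) \<longrightarrow> (\<forall>x\<in>{m 6..m 7}. cost_fun (m' 6) \<le> cost_fun x)) \<and>
     (\<forall>x\<in>{0, 1, 3, 4, 5}. m' x = m x))"
proof -
  let ?f = cost_fun
  let ?I = "\<lambda>m'. 1 \<le> m' 6 \<and> m' 6 \<le> M \<and> 1 \<le> m' 7 \<and> m' 7 \<le> M \<and>
     (convex_between ?f (m 6) (m 7) \<and> m 6 \<le> m 7 \<longrightarrow> m 6 \<le> m' 6 \<and> m' 6 \<le> m' 7 \<and> m' 7 \<le> m 7 \<and>
        (\<forall>x\<in>{m 6..m 7}. \<exists>y\<in>{m' 6..m' 7}. ?f y \<le> ?f x)) \<and>
     (\<forall>x\<in>{0, 1, 3, 4, 5}. m' x = m x)"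
  let ?N = "1 + (1 + (load_time + (1 + (1 + (load_time + (1 + 1))))))"
  let ?b = "Sub (Var 7) (Var 6)"
  have "wp search_com m (floorlog 2 (m 7 - m 6) * (?N + 1) + 1) (\<lambda>m'. ?I m' \<and> val xs m' ?b = 0)"
    unfolding search_com_def
  proof (rule wp_While[where \<mu> = "\<lambda>m. floorlog 2 (m 7 - m 6)"])
    fix m1 assume I: "?I m1" and "val xs m1 ?b \<noteq> 0"
    then have lt: "m1 6 < m1 7" by simp
    define mid where "mid = (m1 6 + m1 7) div 2"
    have mid: "m1 6 \<le> mid" "mid < m1 7" "1 \<le> mid" "mid < M" "Suc mid \<le> V"
      using lt I M_bounds by (auto simp: mid_def)
    have V7: "m1 6 \<le> V" "m1 7 \<le> V" using I M_bounds by auto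
    \<comment> \<open>Either remaining gap is at most half the old one, and halving a positive
      number shortens its binary expansion.\<close>
    have dec: "floorlog 2 (mid - m1 6) < floorlog 2 (m1 7 - m1 6)"
       "floorlog 2 (m1 7 - Suc mid) < floorlog 2 (m1 7 - m1 6)"
      using lt by (auto intro!: le_less_trans[OF floorlog_mono floorlog_2_div_2] simp: mid_def)
    show "wp (Seq (Set 17 (Div (Add (Var 6) (Var 7)) (Const 2)))
     (Seq (Set 8 (Var 17)) (Seq load_com (Seq (Set 2 (Var 9))
     (Seq (Set 8 (Add (Var 17) (Const 1))) (Seq load_com
     (Cond (Sub (Var 2) (Var 9)) (Set 6 (Add (Var 17) (Const 1))) (Set 7 (Var 17)))))))))
      m1 ?N (\<lambda>m'. ?I m' \<and> floorlog 2 (m' 7 - m' 6) < floorlog 2 (m1 7 - m1 6))" (is "wp _ _ _ ?Q")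
    proof (intro wp_Seq wp_Store)
      let ?m2 = "m1(17 := val xs m1 (Div (Add (Var 6) (Var 7)) (Const 2)))"
      let ?m3 = "?m2(8 := val xs ?m2 (Var 17))"
      have m3: "?m3 8 = mid" "?m3 17 = mid" "\<And>x. x < 8 \<Longrightarrow> ?m3 x = m1 x" by (auto simp: mid_def)
      show "wp load_com ?m3 load_time (\<lambda>m'. wp (Seq (Set 2 (Var 9))
        (Seq (Set 8 (Add (Var 17) (Const 1))) (Seq load_com
        (Cond (Sub (Var 2) (Var 9)) (Set 6 (Add (Var 17) (Const 1))) (Set 7 (Var 17)))))) m'
        (1 + (1 + (load_time + (1 + 1)))) ?Q)"
      proof (rule wp_mono[OF wp_load order.refl], intro wp_Seq wp_Store)
        fix m4 assume m4: "m4 9 = load jss l (?m3 8) \<and> (\<forall>x. x \<notin> {9..16} \<longrightarrow> m4 x = ?m3 x)"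
        have m4': "m4 9 = ?f mid" "m4 17 = mid" "\<And>x. x < 8 \<Longrightarrow> m4 x = m1 x"
          using m4 m3 by auto
        show "val xs m4 (Var 9) \<le> V"
          using m4' load_le_V by simp
        let ?m5 = "m4(2 := val xs m4 (Var 9))"
        let ?m6 = "?m5(8 := val xs ?m5 (Add (Var 17) (Const 1)))"
        have m6: "?m6 8 = Suc mid" "?m6 17 = mid" "?m6 2 = ?f mid" "\<And>x. x < 8 \<Longrightarrow> x \<noteq> 2 \<Longrightarrow> ?m6 x = m1 x"
          using m4' by auto
        show "val xs ?m5 (Add (Var 17) (Const 1)) \<le> V" using m4' mid by simp
        show "wp load_com ?m6 load_time (\<lambda>m'. wp
          (Cond (Sub (Var 2) (Var 9)) (Set 6 (Add (Var 17) (Const 1))) (Set 7 (Var 17))) m' (1 + 1) ?Q)"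
        proof (rule wp_mono[OF wp_load order.refl], intro wp_Cond wp_Store)
          fix m7 assume m7: "m7 9 = load jss l (?m6 8) \<and> (\<forall>x. x \<notin> {9..16} \<longrightarrow> m7 x = ?m6 x)"
          have m7': "m7 9 = ?f (Suc mid)" "m7 2 = ?f mid" "m7 17 = mid"
            "\<And>x. x < 8 \<Longrightarrow> x \<noteq> 2 \<Longrightarrow> m7 x = m1 x"
            using m7 m6 by auto
          note step = convex_search_step[of ?f "m 6" "m 7" "m1 6" "m1 7", folded mid_def]
          show "val xs m7 (Add (Var 17) (Const 1)) \<le> V" using m7' mid by simp
          show "val xs m7 (Var 17) \<le> V" using m7' mid by simp
          show "?Q (m7(6 := val xs m7 (Add (Var 17) (Const 1))))" if "val xs m7 (Sub (Var 2) (Var 9)) \<noteq> 0"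
            using that m7' I mid dec lt step(1) by auto
          show "?Q (m7(7 := val xs m7 (Var 17)))" if "val xs m7 (Sub (Var 2) (Var 9)) = 0"
            using that m7' I mid dec lt step(2) by auto
        qed auto
      qed auto
    qed (use mid V7 in \<open>auto simp: mid_def\<close>)
  qed (use assms in auto)
  then show ?thesis
  proof (rule wp_mono)
    have "floorlog 2 (m 7 - m 6) \<le> floorlog 2 M" using assms by (intro floorlog_mono) auto
    then show "floorlog 2 (m 7 - m 6) * (?N + 1) + 1 \<le> search_time"
      unfolding search_time_def by (intro add_mono mult_le_mono1) auto
  next
    fix m' assume m': "?I m' \<and> val xs m' ?b = 0"
    have "cost_fun (m' 6) \<le> cost_fun x" if conv: "convex_between cost_fun (m 6) (m 7)" and x: "x \<in> {m 6..m 7}" for x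
    proof -
      have "m 6 \<le> m 7" using x by simp
      then have "\<forall>x\<in>{m 6..m 7}. \<exists>y\<in>{m' 6..m' 7}. ?f y \<le> ?f x" using m' conv by blast
      then obtain y where "y \<in> {m' 6..m' 7}" "?f y \<le> ?f x" using x by blast
      moreover have "m' 7 \<le> m' 6" using m' by simp
      ultimately have "m' 6 = y" "?f y \<le> ?f x" by auto
      then show ?thesis by simp
    qed
    then show "1 \<le> m' 6 \<and> m' 6 \<le> M \<and>
     (convex_between cost_fun (m 6) (m 7) \<longrightarrow> (\<forall>x\<in>{m 6..m 7}. cost_fun (m' 6) \<le> cost_fun x)) \<and>
     (\<forall>x\<in>{0, 1, 3, 4, 5}. m' x = m x)" using m' by simp
  qed
qed

lemma wp_update:
  assumes "m 0 \<le> V" "m 6 \<le> V"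
  shows "wp update_com m (1 + (load_time + (1 + (1 + (load_time + (1 + 1))))))
     (\<lambda>m'. m' 0 \<in> {m 0, m 6} \<and> cost_fun (m' 0) \<le> cost_fun (m 0) \<and> cost_fun (m' 0) \<le> cost_fun (m 6) \<and>
       (\<forall>x\<in>{1, 3, 4, 5}. m' x = m x))" (is "wp _ _ _ ?Q")
  unfolding update_com_def
proof (intro wp_Seq wp_Store)
  let ?f = cost_fun
  let ?m1 = "m(8 := val xs m (Var 0))"
  show "wp load_com ?m1 load_time (\<lambda>m'. wp (Seq (Set 2 (Var 9)) (Seq (Set 8 (Var 6)) (Seq load_com
     (Cond (Sub (Var 2) (Var 9)) (Set 0 (Var 6)) Skip)))) m' (1 + (1 + (load_time + (1 + 1)))) ?Q)"
  proof (rule wp_mono[OF wp_load order.refl], intro wp_Seq wp_Store)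
    fix m2 assume m2: "m2 9 = load jss l (?m1 8) \<and> (\<forall>x. x \<notin> {9..16} \<longrightarrow> m2 x = ?m1 x)"
    have m2': "m2 9 = ?f (m 0)" "\<And>x. x < 8 \<Longrightarrow> m2 x = m x" using m2 by auto
    show "val xs m2 (Var 9) \<le> V" using m2' load_le_V by simp
    let ?m3 = "m2(2 := val xs m2 (Var 9))"
    let ?m4 = "?m3(8 := val xs ?m3 (Var 6))"
    have m4: "?m4 8 = m 6" "?m4 2 = ?f (m 0)" "\<And>x. x < 8 \<Longrightarrow> x \<noteq> 2 \<Longrightarrow> ?m4 x = m x"
      using m2' by auto
    show "val xs ?m3 (Var 6) \<le> V" using m2' assms by simp
    show "wp load_com ?m4 load_time (\<lambda>m'. wp (Cond (Sub (Var 2) (Var 9)) (Set 0 (Var 6)) Skip) m' (1 + 1) ?Q)"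
    proof (rule wp_mono[OF wp_load order.refl], intro wp_Cond wp_Store wp_Skip)
      fix m5 assume m5: "m5 9 = load jss l (?m4 8) \<and> (\<forall>x. x \<notin> {9..16} \<longrightarrow> m5 x = ?m4 x)"
      have m5': "m5 9 = ?f (m 6)" "m5 2 = ?f (m 0)" "\<And>x. x < 8 \<Longrightarrow> x \<noteq> 2 \<Longrightarrow> m5 x = m x"
        using m5 m4 by auto
      show "val xs m5 (Var 6) \<le> V" using m5' assms by simp
      show "?Q (m5(0 := val xs m5 (Var 6)))" if "val xs m5 (Sub (Var 2) (Var 9)) \<noteq> 0"
        using that m5' by auto
      show "?Q m5" if "val xs m5 (Sub (Var 2) (Var 9)) = 0"
        using that m5' by auto
    qed auto
  qed auto
qed (use assms in auto)

definition covered :: "nat \<Rightarrow> nat \<Rightarrow> nat \<Rightarrow> bool" where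
  "covered t a b \<longleftrightarrow> (convex_between cost_fun (cand a) (cand b) \<longrightarrow>
     (\<forall>x\<in>{cand a..cand b}. cost_fun t \<le> cost_fun x))"

text \<open>Updates never raise the load of the best position, so a pair once covered stays
  covered.\<close>

lemma covered_mono: "covered t a b \<Longrightarrow> cost_fun t' \<le> cost_fun t \<Longrightarrow> covered t' a b"
  unfolding covered_def by (meson order_trans)

definition pair_time :: nat where
  "pair_time = 1 + (1 + (search_time + (1 + (load_time + (1 + (1 + (load_time + (1 + 1))))))))"

lemma wp_pair:
  assumes "m 1 = M" "1 \<le> m 0" "m 0 \<le> M"
  shows "wp (Seq (Set 6 (Cand_exp 4)) (Seq (Set 7 (Cand_exp 5)) (Seq search_com update_com))) m pair_time
    (\<lambda>m'. 1 \<le> m' 0 \<and> m' 0 \<le> M \<and> cost_fun (m' 0) \<le> cost_fun (m 0) \<and> covered (m' 0) (m 4) (m 5) \<and>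
       (\<forall>x\<in>{1, 3, 4, 5}. m' x = m x))" (is "wp _ _ _ ?Q")
  unfolding pair_time_def
proof (intro wp_Seq wp_Store)
  let ?m1 = "m(6 := val xs m (Cand_exp 4))"
  let ?m2 = "?m1(7 := val xs ?m1 (Cand_exp 5))"
  have e1: "val xs m (Cand_exp 4) = cand (m 4)" using assms by (intro Cand_exp_simps)
  have e2: "val xs ?m1 (Cand_exp 5) = cand (m 5)" using assms Cand_exp_simps(1)[of ?m1 5] by simp
  show "val xs m (Cand_exp 4) \<le> V"
    unfolding e1 by (rule order_trans[OF cand_bounds(2) M_bounds(2)])
  show "val xs ?m1 (Cand_exp 5) \<le> V"
    unfolding e2 by (rule order_trans[OF cand_bounds(2) M_bounds(2)])
  show "wp search_com ?m2 search_time (\<lambda>m'. wp update_com m'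
      (1 + (load_time + (1 + (1 + (load_time + (1 + 1)))))) ?Q)"
  proof (rule wp_mono[OF wp_search order.refl], unfold e2, unfold e1)
    fix m3 assume m3: "1 \<le> m3 6 \<and> m3 6 \<le> M \<and>
     (convex_between cost_fun ((m(6 := cand (m 4), 7 := cand (m 5))) 6) ((m(6 := cand (m 4), 7 := cand (m 5))) 7) \<longrightarrow>
       (\<forall>x\<in>{(m(6 := cand (m 4), 7 := cand (m 5))) 6..(m(6 := cand (m 4), 7 := cand (m 5))) 7}. cost_fun (m3 6) \<le> cost_fun x)) \<and>
     (\<forall>x\<in>{0, 1, 3, 4, 5}. m3 x = (m(6 := cand (m 4), 7 := cand (m 5))) x)"
    then have cov: "covered (m3 6) (m 4) (m 5)" and m30: "m3 0 = m 0" by (simp_all add: covered_def)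
    have "m3 0 \<le> V" "m3 6 \<le> V" using m3 m30 assms M_bounds by auto
    then show "wp update_com m3 (1 + (load_time + (1 + (1 + (load_time + (1 + 1)))))) ?Q"
    proof (rule wp_mono[OF wp_update order.refl])
      fix m4 assume "m4 0 \<in> {m3 0, m3 6} \<and> cost_fun (m4 0) \<le> cost_fun (m3 0) \<and> cost_fun (m4 0) \<le> cost_fun (m3 6) \<and>
       (\<forall>x\<in>{1, 3, 4, 5}. m4 x = m3 x)"
      then show "?Q m4" using m3 m30 assms covered_mono[OF cov] by auto
    qed
  qed (use cand_bounds in auto)
qed (use Cand_exp_simps(2)[of 4] Cand_exp_simps(2)[of 5] in auto)

definition main_time :: nat where
  "main_time = 1 + (1 + ((L * (1 + 2) + 2) + (1 + (1 + (2 * L * ((2 * L * (pair_time + 2) + 2) + 2) + 2)))))"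

lemma wp_main:
  "wp main_com (\<lambda>_. 0) main_time (\<lambda>m'. 1 \<le> m' 0 \<and> m' 0 \<le> M \<and> (\<forall>a<2 * L. \<forall>b<2 * L. covered (m' 0) a b))"
    (is "wp _ _ _ ?Q")
  unfolding main_com_def main_time_def
proof (intro wp_Seq wp_Store)
  let ?body = "Seq (Set 6 (Cand_exp 4)) (Seq (Set 7 (Cand_exp 5)) (Seq search_com update_com))"
  let ?parse = "For 4 (Input (Const 3)) (Set 3 (Add (Var 3) (Add (Const 1) (Mul (Const 3) (Input (Var 3))))))"
  let ?N = "1 + (1 + (2 * L * ((2 * L * (pair_time + 2) + 2) + 2) + 2))"
  let ?m0 = "\<lambda>_::nat. 0::nat"
  let ?m1 = "?m0(1 := val xs ?m0 (Max_exp (Const 1) (Sub (Add (Input (Const 0)) (Const 1)) (Input (Const 2)))))"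
  let ?m2 = "?m1(3 := val xs ?m1 (Const 4))"
  let ?I = "\<lambda>j m. (m :: nat \<Rightarrow> nat) 1 = M \<and> m 3 = off j"
  have LV: "2 * L \<le> V" "L \<le> V" using V by auto
  show "val xs ?m0 (Max_exp (Const 1) (Sub (Add (Input (Const 0)) (Const 1)) (Input (Const 2)))) \<le> V"
    using M_bounds by (simp add: cell0 cell2 M_def)
  have "wp ?parse ?m2 (L * (1 + 2) + 2) (\<lambda>m'. m' 4 = length jss \<and> ?I (length jss) m')"
  proof (rule wp_For)
    fix j m assume j: "j < length jss" and I: "?I j m" and m: "m 4 = j"
    let ?e = "Add (Var 3) (Add (Const 1) (Mul (Const 3) (Input (Var 3))))"
    have e: "val xs m ?e = off (Suc j)" using I off_Suc[OF j] agent_at[OF j] by (simp add: agent_at_def)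
    show "wp (Set 3 ?e) m 1 (\<lambda>m'. m' 4 = j \<and> ?I (Suc j) (m'(4 := Suc j)))"
    proof (rule wp_Store)
      show "val xs m ?e \<le> V" unfolding e using off_le_L[of "Suc j"] j LV by simp
      show "(m(3 := val xs m ?e)) 4 = j \<and> ?I (Suc j) ((m(3 := val xs m ?e))(4 := Suc j))"
        unfolding e using I m by simp
    qed simp
  qed (use LV lengths_le off_0 in \<open>auto simp: cell3 cell0 cell2 M_def\<close>)
  then show "wp ?parse ?m2 (L * (1 + 2) + 2) (\<lambda>m'. wp (Seq (Set 3 (Mul (Const 2) (Var 3)))
     (Seq (Set 0 (Const 1)) (For 4 (Var 3) (For 5 (Var 3) ?body)))) m' ?N ?Q)"
  proof (rule wp_mono[OF _ order.refl], intro wp_Seq wp_Store)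
    fix m3 assume m3: "m3 4 = length jss \<and> ?I (length jss) m3"
    let ?m4 = "m3(3 := val xs m3 (Mul (Const 2) (Var 3)))"
    let ?m5 = "?m4(0 := val xs ?m4 (Const 1))"
    have e: "val xs m3 (Mul (Const 2) (Var 3)) = 2 * L" using m3 by (simp add: off_length)
    show "val xs m3 (Mul (Const 2) (Var 3)) \<le> V" unfolding e using LV by simp
    let ?G = "\<lambda>m. (m :: nat \<Rightarrow> nat) 1 = M \<and> m 3 = 2 * L \<and> 1 \<le> m 0 \<and> m 0 \<le> M"
    let ?J = "\<lambda>a m. ?G m \<and> (\<forall>a'<a. \<forall>b<2 * L. covered (m 0) a' b)"
    have "wp (For 4 (Var 3) (For 5 (Var 3) ?body)) ?m5 (2 * L * ((2 * L * (pair_time + 2) + 2) + 2) + 2)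
       (\<lambda>m'. m' 4 = 2 * L \<and> ?J (2 * L) m')"
    proof (rule wp_For[where Inv = ?J])
      fix a m assume a: "a < 2 * L" and J: "?J a m" and m: "m 4 = a"
      let ?K = "\<lambda>b m. m 4 = a \<and> ?J a m \<and> (\<forall>b'<b. covered (m 0) a b')"
      have "wp (For 5 (Var 3) ?body) m (2 * L * (pair_time + 2) + 2) (\<lambda>m'. m' 5 = 2 * L \<and> ?K (2 * L) m')"
      proof (rule wp_For[where Inv = ?K])
        fix b m assume b: "b < 2 * L" and K: "?K b m" and m: "m 5 = b"
        show "wp ?body m pair_time (\<lambda>m'. m' 5 = b \<and> ?K (Suc b) (m'(5 := Suc b)))"
        proof (rule wp_mono[OF wp_pair order.refl])
          fix m' assume m': "1 \<le> m' 0 \<and> m' 0 \<le> M \<and> cost_fun (m' 0) \<le> cost_fun (m 0) \<and>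
            covered (m' 0) (m 4) (m 5) \<and> (\<forall>x\<in>{1, 3, 4, 5}. m' x = m x)"
          then have "covered (m' 0) a' b'" if "covered (m 0) a' b'" for a' b'
            using that covered_mono by blast
          then show "m' 5 = b \<and> ?K (Suc b) (m'(5 := Suc b))"
            using m' K m by (auto simp: less_Suc_eq)
        qed (use K in auto)
      qed (use LV J m in auto)
      then show "wp (For 5 (Var 3) ?body) m (2 * L * (pair_time + 2) + 2) (\<lambda>m'. m' 4 = a \<and> ?J (Suc a) (m'(4 := Suc a)))"
        by (rule wp_mono) (auto simp: less_Suc_eq)
    qed (use LV m3 M_bounds in \<open>auto simp: off_length\<close>)
    then show "wp (For 4 (Var 3) (For 5 (Var 3) ?body)) ?m5 (2 * L * ((2 * L * (pair_time + 2) + 2) + 2) + 2) ?Q"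
      by (rule wp_mono) auto
  qed (use M_bounds in auto)
qed (use V in auto)

end

section \<open>Reading the instance\<close>

context psba_input
begin

lemma field_is_cell:
  assumes "i < length jss" "k < length (jss ! i)" "c \<le> 3"
  shows "\<exists>x<L. cell xs x = field xs (off i) k c"
proof -
  have "off i + (3 * k + c) < off (Suc i)" using assms by (simp add: off_Suc)
  also have "\<dots> \<le> L" using assms by (intro off_le_L) simp
  finally show ?thesis by (auto simp: field_def)
qed

lemma cand_cell:
  assumes "x < L"
  shows "max 1 (min M (cell xs x)) \<in> cand ` {..<2 * L}"
    and "max 1 (min M (cell xs x + 1 - l)) \<in> cand ` {..<2 * L}"
proof -
  have "cand (2 * x) = max 1 (min M (cell xs x))" by (simp add: cand_def)
  then show "max 1 (min M (cell xs x)) \<in> cand ` {..<2 * L}" using assms by (intro image_eqI[of _ _ "2 * x"]) auto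
  have "cand (2 * x + 1) = max 1 (min M (cell xs x + 1 - l))" by (simp add: cand_def)
  then show "max 1 (min M (cell xs x + 1 - l)) \<in> cand ` {..<2 * L}"
    using assms by (intro image_eqI[of _ _ "2 * x + 1"]) auto
qed

lemma cand_release_deadline:
  assumes "js \<in> set jss" "j \<in> set js"
  shows "max 1 (min M (release j)) \<in> cand ` {..<2 * L}"
    and "max 1 (min M (deadline j + 1 - l)) \<in> cand ` {..<2 * L}"
proof -
  obtain i k where i: "i < length jss" "js = jss ! i" "k < length js" "j = js ! k"
    using assms by (metis in_set_conv_nth)
  have "field xs (off i) k 1 = release j" "field xs (off i) k 2 = deadline j"
    using agent_at[OF i(1)] i by (auto simp: agent_at_def)
  then obtain x y where "x < L" "cell xs x = release j" "y < L" "cell xs y = deadline j"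
    using field_is_cell[of i k 1] field_is_cell[of i k 2] i by auto
  then show "max 1 (min M (release j)) \<in> cand ` {..<2 * L}"
    and "max 1 (min M (deadline j + 1 - l)) \<in> cand ` {..<2 * L}"
    using cand_cell by metis+
qed

text \<open>Take the nearest candidates on either side of \<open>x\<close>, both equal to
  \<open>x\<close> if it is a candidate. No candidate lies strictly between them, hence no
  exceptional point either.\<close>

lemma adjacent_candidates:
  assumes "1 \<le> x" "x \<le> M"
  shows "\<exists>a<2 * L. \<exists>b<2 * L. cand a \<le> x \<and> x \<le> cand b \<and> convex_between cost_fun (cand a) (cand b)"
proof -
  let ?K = "cand ` {..<2 * L}"
  have L: "1 < L" "0 < L" using off_ge[of "length jss"] off_length by auto
  have K: "1 \<in> ?K" "M \<in> ?K"
  proof -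
    \<comment> \<open>The number of events in cell 1 yields the candidate 1; the horizon in cell 0,
      taken as a candidate of the second kind, yields \<open>M\<close>.\<close>
    have "max 1 (min M (cell xs 1)) = 1" "max 1 (min M (cell xs 0 + 1 - l)) = M"
      using M_bounds cell1 by (auto simp: cell0 M_def)
    then show "1 \<in> ?K" "M \<in> ?K" using cand_cell(1)[OF L(1)] cand_cell(2)[OF L(2)] by simp_all
  qed
  define p where "p = Max {k \<in> ?K. k \<le> x}"
  define q where "q = Min {k \<in> ?K. x \<le> k}"
  have "p \<in> {k \<in> ?K. k \<le> x}" unfolding p_def using K(1) assms(1) by (intro Max_in) auto
  then have p: "p \<in> ?K" "p \<le> x" by blast+
  have "q \<in> {k \<in> ?K. x \<le> k}" unfolding q_def using K(2) assms(2) by (intro Min_in) auto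
  then have q: "q \<in> ?K" "x \<le> q" by blast+
  have gap: "t \<notin> ?K" if "p < t" "t < q" for t
  proof
    assume t: "t \<in> ?K"
    show False
    proof (cases "t \<le> x")
      case True
      then have "t \<le> p" unfolding p_def using t by (intro Max_ge) auto
      then show False using that by simp
    next
      case False
      then have "q \<le> t" unfolding q_def using t by (intro Min_le) auto
      then show False using that by simp
    qed
  qed
  have "q \<le> M" using q cand_bounds by auto
  have "convex_between cost_fun p q"
    unfolding convex_between_def
  proof (intro allI impI load_convex)
    fix t js j assume t: "p \<le> t \<and> Suc (Suc t) \<le> q" and j: "js \<in> set jss" "j \<in> set js"
    have "Suc t \<notin> ?K" using gap t by auto
    \<comment> \<open>Clipping fixes interior points, so an exceptional one would itself be a
      candidate.\<close>
    moreover have "max 1 (min M (Suc t)) = Suc t" using t \<open>q \<le> M\<close> by auto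
    moreover have "deadline j + 1 - l = Suc t" if "Suc t + l = deadline j + 1" using that by simp
    ultimately show "Suc t \<noteq> release j \<and> Suc t + l \<noteq> deadline j + 1"
      using cand_release_deadline[OF j] by metis
  qed
  then show ?thesis using p q by auto
qed

lemma covered_imp_minimal:
  assumes "\<forall>a<2 * L. \<forall>b<2 * L. covered t a b" "1 \<le> x" "x \<le> M"
  shows "cost_fun t \<le> cost_fun x"
  using adjacent_candidates[OF assms(2,3)] assms(1) unfolding covered_def by fastforce

end

section \<open>Layout and size of the encoding\<close>

lemma length_encode_jobs: "length (concat (map encode_job js)) = 3 * length js"
  by (induction js) (auto simp: encode_job_def)

lemma length_encode_agent: "length (encode_agent js) = 1 + 3 * length js"
  by (simp add: encode_agent_def length_encode_jobs)

lemma nth_encode_jobs: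
  "k < length js \<Longrightarrow> c < 3 \<Longrightarrow> concat (map encode_job js) ! (3 * k + c) = encode_job (js ! k) ! c"
proof (induction js arbitrary: k)
  case (Cons j js)
  have 3: "length (encode_job j) = 3" by (simp add: encode_job_def)
  show ?case
  proof (cases k)
    case 0
    then show ?thesis using Cons.prems 3 by (simp add: nth_append)
  next
    case (Suc k')
    have "3 * k + c - 3 = 3 * k' + c" using Suc by simp
    then show ?thesis using Suc Cons 3 by (simp add: nth_append)
  qed
qed simp

lemma sum_total_proc_le: "(\<Sum>i<length jss. total_proc (jss ! i)) \<le> sum_list (concat (map encode_agent jss))"
proof -
  have *: "total_proc js \<le> sum_list (encode_agent js)" for js
  proof -
    have "total_proc js = sum_list (map proc_time js)"
      by (simp add: total_proc_def sum_list_sum_nth atLeast0LessThan)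
    also have "\<dots> \<le> sum_list (concat (map encode_job js))"
      by (induction js) (auto simp: encode_job_def)
    finally show ?thesis by (simp add: encode_agent_def)
  qed
  have "(\<Sum>i<length jss. total_proc (jss ! i)) = sum_list (map total_proc jss)"
    by (simp add: sum_list_sum_nth atLeast0LessThan)
  also have "\<dots> \<le> sum_list (concat (map encode_agent jss))"
    using * by (induction jss) (auto intro: add_mono)
  finally show ?thesis .
qed

definition offset :: "job list list \<Rightarrow> nat \<Rightarrow> nat" where
  "offset jss i = 4 + length (concat (map encode_agent (take i jss)))"

lemma agent_at_offset:
  assumes "length pre = 4" "i < length jss"
  shows "agent_at (pre @ concat (map encode_agent jss)) (offset jss i) (jss ! i)"
proof -
  let ?xs = "pre @ concat (map encode_agent jss)" and ?js = "jss ! i"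
  have split: "?xs = (pre @ concat (map encode_agent (take i jss))) @ encode_agent ?js @
      concat (map encode_agent (drop (Suc i) jss))"
    by (subst id_take_nth_drop[OF assms(2)]) simp
  have c: "cell ?xs (offset jss i + d) = encode_agent ?js ! d" if "d < 1 + 3 * length ?js" for d
    unfolding split using that assms(1)
    by (simp add: cell_def offset_def nth_append length_encode_agent del: length_concat)
  have "field ?xs (offset jss i) k (Suc d) = encode_job (?js ! k) ! d" if "k < length ?js" "d < 3" for k d
    using c[of "3 * k + Suc d"] that nth_encode_jobs[of k ?js d] by (simp add: field_def encode_agent_def)
  from this[of _ 0] this[of _ 1] this[of _ 2] show ?thesis
    using c[of 0] by (simp add: agent_at_def encode_agent_def encode_job_def numeral_2_eq_2 numeral_3_eq_3)
qed

text \<open>Since \<open>1 + x + y \<le> (1 + x) * (1 + y)\<close>, adding numbers costs no more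
  bits than concatenating them; this is what makes \<open>num_bits V\<close> linear in the input
  size.\<close>

lemma sum_list_less: "sum_list xs < 2 ^ input_size xs"
proof (induction xs)
  case (Cons x xs)
  have "Suc (x + sum_list xs) \<le> Suc x * Suc (sum_list xs)" by simp
  also have "\<dots> \<le> 2 ^ num_bits x * 2 ^ input_size xs"
    using Cons less_two_power_num_bits[of x] by (intro mult_le_mono) auto
  finally show ?case by (simp add: input_size_def power_add)
qed (simp add: input_size_def)

lemma length_le_input_size: "length xs \<le> input_size xs"
proof (induction xs)
  case (Cons x xs)
  then show ?case using num_bits_ge_1[of x] by (simp add: input_size_def)
qed simp

text \<open>The polynomials copy the time bounds term by term, with the variable in place of
  \<open>L\<close> and \<open>[:4, 1:]\<close> in place of \<open>floorlog 2 M\<close>, so that the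
  comparison is mere monotonicity.\<close>

definition load_poly :: "nat poly" where
  "load_poly = (let X = [:0, 1:] in
     1 + (1 + (X * (1 + (X * ((X * ((3 * X + 3 + (1 + 1)) + 2) + 2) + 2) + 2) + (1 + 1) + 2) + 2)))"

definition pair_poly :: "nat poly" where
  "pair_poly = 1 + (1 + (([:4, 1:] * (1 + (1 + (load_poly + (1 + (1 + (load_poly + (1 + 1)))))) + 1) + 1) +
     (1 + (load_poly + (1 + (1 + (load_poly + (1 + 1))))))))"

definition main_poly :: "nat poly" where
  "main_poly = (let X = [:0, 1:] in
     1 + (1 + ((X * (1 + 2) + 2) + (1 + (1 + (2 * X * ((2 * X * (pair_poly + 2) + 2) + 2) + 2))))))"

lemma (in psba_input) main_time_le:
  assumes "L \<le> s" "num_bits V \<le> s + 4"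
  shows "main_time \<le> poly main_poly s"
proof -
  have "floorlog 2 M \<le> floorlog 2 V" using M_bounds by (intro floorlog_mono)
  also have "\<dots> \<le> 4 + s" using assms(2) by (simp add: num_bits_def)
  finally have F: "floorlog 2 M \<le> 4 + s" .
  have X: "poly [:0, 1:] s = s" "poly [:4, 1:] s = 4 + s" by simp_all
  note eval_poly = poly_add poly_mult poly_1 poly_numeral X
  have load: "load_time \<le> poly load_poly s"
    unfolding load_time_def load_poly_def Let_def eval_poly
    by (intro add_mono mult_le_mono order.refl assms(1))
  have pair: "pair_time \<le> poly pair_poly s"
    unfolding pair_time_def search_time_def pair_poly_def eval_poly
    by (intro add_mono mult_le_mono order.refl load F)
  show ?thesis
    unfolding main_time_def main_poly_def Let_def eval_poly
    by (intro add_mono mult_le_mono order.refl pair assms(1))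
qed

theorem theorem4:
  "\<exists>c. solves_in_poly_time c encode_psba
         (\<lambda>I. valid_psba I \<and> card (events I) = 1)
         (\<lambda>I t. \<forall>e\<in>events I. optimal_position I e t)"
proof -
  have "\<exists>n m. run (encode_psba I) main_com (\<lambda>_. 0) n m \<and>
      n \<le> poly (main_poly * ([:unit_cost:] * [:4, 1:])) (input_size (encode_psba I)) \<and>
      (\<forall>e\<in>events I. optimal_position I e (m 0))"
    if I: "valid_psba I" "card (events I) = 1" for I
  proof -
    define xs where "xs = encode_psba I"
    define jss where "jss = agent_jobs I"
    obtain l where l: "event_lengths I = [l]"
      using I(2) by (auto simp: events_def length_Suc_conv)
    have xs: "xs = [horizon I, 1, l, length jss] @ concat (map encode_agent jss)"
      by (simp add: xs_def encode_psba_def l jss_def)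
    \<comment> \<open>Large enough for the locale, yet below \<open>2 ^ (s + 4)\<close>, because the
      sum and the length of the input are both below \<open>2 ^ s\<close>.\<close>
    define V where "V = 2 * sum_list xs + 2 * length xs + 10"
    define s where "s = input_size xs"
    have "V < 2 ^ (s + 4)"
    proof -
      have "length xs < 2 ^ s"
        unfolding s_def by (rule le_less_trans[OF length_le_input_size less_exp])
      moreover have "sum_list xs < 2 ^ s" by (simp add: s_def sum_list_less)
      ultimately show ?thesis by (simp add: V_def power_add)
    qed
    then have bits: "num_bits V \<le> s + 4" by (rule num_bits_le) simp
    interpret psba_input xs V "horizon I" l "length xs" jss "offset jss"
    proof
      show "x \<le> V" if "x \<in> set xs" for x using member_le_sum_list[OF that] by (simp add: V_def)
      show "offset jss (Suc i) = offset jss i + (1 + 3 * length (jss ! i))" if "i < length jss" for i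
        using that by (simp add: offset_def take_Suc_conv_app_nth length_encode_agent)
      show "agent_at xs (offset jss i) (jss ! i)" if "i < length jss" for i
        unfolding xs using that by (intro agent_at_offset) auto
      have "(\<Sum>i<length jss. total_proc (jss ! i)) \<le> sum_list xs"
        using sum_total_proc_le[of jss] by (simp add: xs)
      then show "(\<Sum>i<length jss. total_proc (jss ! i)) \<le> V" by (simp add: V_def)
      show "horizon I + 2 * length xs + 10 \<le> V" by (simp add: V_def xs)
      show "2 \<le> V" by (simp add: V_def)
      show "offset jss (length jss) = length xs" by (simp add: offset_def xs)
    qed (auto simp: xs cell_def offset_def)
    obtain n m where run: "run xs main_com (\<lambda>_. 0) n m" and n: "n \<le> main_time * (unit_cost * num_bits V)"
      and m: "1 \<le> m 0" "m 0 \<le> M" "\<forall>a<2 * length xs. \<forall>b<2 * length xs. covered (m 0) a b"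
      using wp_main by (auto simp: wp_def)
    have "n \<le> poly (main_poly * ([:unit_cost:] * [:4, 1:])) s"
    proof -
      have "main_time * (unit_cost * num_bits V) \<le> poly main_poly s * (unit_cost * (s + 4))"
        using main_time_le[of s] bits length_le_input_size[of xs] by (intro mult_le_mono) (auto simp: s_def)
      also have "\<dots> = poly (main_poly * ([:unit_cost:] * [:4, 1:])) s" by (simp add: algebra_simps)
      finally show ?thesis using n by (rule order_trans[rotated])
    qed
    moreover have "optimal_position I e (m 0)" if e: "e \<in> events I" for e
    proof -
      have "event_lengths I ! e = l" using e l by (simp add: events_def)
      then show ?thesis
        using optimal_position_if_min_load[OF I(1) e, of "m 0"] m(1,2) covered_imp_minimal[OF m(3)]
        by (simp add: jss_def M_def)
    qed
    ultimately show ?thesis using run unfolding xs_def s_def by blast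
  qed
  then show ?thesis unfolding solves_in_poly_time_def by blast
qed

end
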